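(* Let $N\ge 2$ and let $A\in M_N(\mathbb{C})$ be such that $A$ is not a scalar multiple of the identity matrix $I$ and $\sigma(A)\cap\partial W(A)\neq\emptyset$. If $A_n\to A$ in $M_N(\mathbb{C})$, then $\limsup_{n\to\infty}\psi(A_n)\le C_{N-1}$, where $C_{N-1}:=\sup\{\psi(B): B\in M_{N-1}(\mathbb{C})\}$.
   Context: $M_N(\mathbb{C})$ denotes the algebra of complex $N\times N$ matrices acting on $\mathbb{C}^N$ with the Euclidean inner product, equipped with the operator norm. $\sigma(A)$ is the spectrum of $A$. The numerical range is $W(A):=\{\langle Ax,x\rangle: \|x\|=1\}$ and $\partial W(A)$ is its boundary in $\mathbb{C}$. The Crouzeix ratio of a matrix $B$ is $\psi(B):=\sup\{\|p(B)\|: p \text{ a polynomial with } |p|\le 1 \text{ on } W(B)\}$. *)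

theory Defs
  imports "HOL-Analysis.Analysis" "Jordan_Normal_Form.Spectral_Radius"
begin

definition vnorm :: "complex vec \<Rightarrow> real" where
  "vnorm v = sqrt (\<Sum>i<dim_vec v. (cmod (v $ i))\<^sup>2)"

definition cinner :: "complex vec \<Rightarrow> complex vec \<Rightarrow> complex" where
  "cinner u v = (\<Sum>i<dim_vec v. u $ i * cnj (v $ i))"

definition opnorm :: "complex mat \<Rightarrow> real" where
  "opnorm B = Sup {vnorm (B *\<^sub>v x) | x. x \<in> carrier_vec (dim_col B) \<and> vnorm x = 1}"

definition num_range :: "complex mat \<Rightarrow> complex set" where
  "num_range B = {cinner (B *\<^sub>v x) x | x. x \<in> carrier_vec (dim_col B) \<and> vnorm x = 1}"

definition poly_mat :: "complex poly \<Rightarrow> complex mat \<Rightarrow> complex mat" where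
  "poly_mat p B = mat (dim_row B) (dim_col B)
     (\<lambda>(i,j). \<Sum>k\<le>degree p. coeff p k * (B ^\<^sub>m k) $$ (i,j))"

definition crouzeix_ratio :: "complex mat \<Rightarrow> ereal" where
  "crouzeix_ratio B = (SUP p \<in> {p. \<forall>z\<in>num_range B. cmod (poly p z) \<le> 1}.
      ereal (opnorm (poly_mat p B)))"

definition crouzeix_const :: "nat \<Rightarrow> ereal" where
  "crouzeix_const M = (SUP B \<in> carrier_mat M M. crouzeix_ratio B)"

end

theory Submission
  imports Defs
begin

text \<open>
  Suppose that the limit superior exceeds \<open>b > C > C\<^bsub>N-1\<^esub>\<close>, and choose admissible polynomials \<open>p\<close>
  with \<open>\<parallel>p(A\<^sub>n)\<parallel> > b\<close> along a subsequence. Triangularize each \<open>A\<^sub>n\<close> unitarily, the diagonal being sorted by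
  distance to an eigenvalue \<open>\<lambda>\<close> of \<open>A\<close> in \<open>\<partial>W(A)\<close>; by compactness the triangular forms \<open>T\<^sub>n\<close> converge to a
  triangular form \<open>T\<close> of \<open>A\<close>. An eigenvalue on the boundary of the numerical range is reducing, so
  \<open>T = \<lambda> I\<^sub>k \<oplus> B\<close> with \<open>\<lambda> \<notin> \<sigma>(B)\<close> and \<open>1 \<le> k \<le> N - 1\<close>. The diagonal blocks of \<open>p(T\<^sub>n)\<close> have norm at most \<open>C\<close>,
  because they sit inside \<open>p\<close> of the leading or trailing \<open>(N-1) \<times> (N-1)\<close> block of \<open>T\<^sub>n\<close>, whose numerical range
  is contained in \<open>W(A\<^sub>n)\<close>. The off-diagonal block solves a Sylvester equation, namely \<open>T\<^sub>n p(T\<^sub>n) = p(T\<^sub>n) T\<^sub>n\<close>,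
  whose right-hand side tends to \<open>0\<close> and whose coefficients stay away from singularity, so it tends to \<open>0\<close>
  and \<open>\<parallel>p(T\<^sub>n)\<parallel> \<le> C + o(1)\<close>, a contradiction.
\<close>

no_notation Finite_Cartesian_Product.vec_nth (infixl \<open>$\<close> 90)

subsection \<open>Vectors, operator norm and unitary matrices\<close>

lemma vnorm_L2: "vnorm v = L2_set (\<lambda>i. cmod (v $ i)) {..<dim_vec v}"
  by (simp add: vnorm_def L2_set_def)

lemma vnorm_nonneg [simp]: "0 \<le> vnorm v"
  by (simp add: vnorm_L2 L2_set_nonneg)

lemma vnorm_sq: "(vnorm v)\<^sup>2 = (\<Sum>i<dim_vec v. (cmod (v $ i))\<^sup>2)"
  by (simp add: vnorm_def sum_nonneg)

lemma vnorm_sq_cinner: "complex_of_real ((vnorm v)\<^sup>2) = cinner v v"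
  by (simp add: vnorm_sq cinner_def complex_norm_square [symmetric])

lemma vnorm_smult: "vnorm (c \<cdot>\<^sub>v v) = cmod c * vnorm v"
proof -
  have "vnorm (c \<cdot>\<^sub>v v) = L2_set (\<lambda>i. cmod c * cmod (v $ i)) {..<dim_vec v}"
    unfolding vnorm_L2 by (rule L2_set_cong) (auto simp: norm_mult)
  then show ?thesis by (simp add: vnorm_L2 L2_set_right_distrib)
qed

lemma vnorm_add_le:
  assumes "u \<in> carrier_vec n" "v \<in> carrier_vec n"
  shows "vnorm (u + v) \<le> vnorm u + vnorm v"
proof -
  have "vnorm (u + v) \<le> L2_set (\<lambda>i. cmod (u $ i) + cmod (v $ i)) {..<n}"
    unfolding vnorm_L2 using assms by (auto intro!: L2_set_mono norm_triangle_ineq)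
  also have "\<dots> \<le> vnorm u + vnorm v"
    unfolding vnorm_L2 using assms L2_set_triangle_ineq by auto
  finally show ?thesis .
qed

lemma vnorm_le_sum: "vnorm v \<le> (\<Sum>i<dim_vec v. cmod (v $ i))"
  unfolding vnorm_L2 by (rule L2_set_le_sum) auto

lemma cmod_le_vnorm: "i < dim_vec v \<Longrightarrow> cmod (v $ i) \<le> vnorm v"
  unfolding vnorm_L2 by (rule member_le_L2_set) auto

lemma vnorm_unit_vec: "i < n \<Longrightarrow> vnorm (unit_vec n i) = 1"
  by (simp add: vnorm_def unit_vec_def if_distrib [of cmod] if_distrib [of "\<lambda>x. x\<^sup>2"] cong: if_cong)

lemma vnorm_zero_iff:
  assumes "v \<in> carrier_vec n"
  shows "vnorm v = 0 \<longleftrightarrow> v = 0\<^sub>v n"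
  using assms unfolding vnorm_L2 by (subst L2_set_eq_0_iff) auto

lemma mult_mat_vec_sum:
  assumes "B \<in> carrier_mat n m" "x \<in> carrier_vec m" "i < n"
  shows "(B *\<^sub>v x) $ i = (\<Sum>j<m. B $$ (i,j) * x $ j)"
  using assms by (auto simp: scalar_prod_def lessThan_atLeast0 intro!: sum.cong)

lemma mult_mat_sum:
  assumes "A \<in> carrier_mat n m" "B \<in> carrier_mat m l" "i < n" "j < l"
  shows "(A * B) $$ (i,j) = (\<Sum>k<m. A $$ (i,k) * B $$ (k,j))"
  using assms by (auto simp: scalar_prod_def lessThan_atLeast0 intro!: sum.cong)

lemma mult_mat_vec_assoc3:
  assumes A: "A \<in> carrier_mat n n" and B: "B \<in> carrier_mat n n" and C: "C \<in> carrier_mat n n"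
    and x: "x \<in> carrier_vec n"
  shows "(A * B * C) *\<^sub>v x = A *\<^sub>v (B *\<^sub>v (C *\<^sub>v x))"
  unfolding assoc_mult_mat_vec [OF mult_carrier_mat [OF A B] C x]
  using C x by (intro assoc_mult_mat_vec [OF A B]) auto

text \<open>This crude entrywise bound shows that the set in the definition of \<open>opnorm\<close>
  is bounded above, and later controls the off-diagonal remainder of a nearly block diagonal
  matrix.\<close>

lemma vnorm_mult_mat_vec_le:
  assumes B: "B \<in> carrier_mat n m" and x: "x \<in> carrier_vec m"
  shows "vnorm (B *\<^sub>v x) \<le> (\<Sum>i<n. \<Sum>j<m. cmod (B $$ (i,j))) * vnorm x"
proof -
  have "cmod ((B *\<^sub>v x) $ i) \<le> (\<Sum>j<m. cmod (B $$ (i,j))) * vnorm x" if "i < n" for i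
  proof -
    have "cmod ((B *\<^sub>v x) $ i) \<le> (\<Sum>j<m. cmod (B $$ (i,j)) * cmod (x $ j))"
      unfolding mult_mat_vec_sum [OF B x that] norm_mult [symmetric] by (rule norm_sum)
    also have "\<dots> \<le> (\<Sum>j<m. cmod (B $$ (i,j)) * vnorm x)"
      using x by (intro sum_mono mult_left_mono cmod_le_vnorm) auto
    finally show ?thesis by (simp add: sum_distrib_right)
  qed
  then have "(\<Sum>i<n. cmod ((B *\<^sub>v x) $ i)) \<le> (\<Sum>i<n. (\<Sum>j<m. cmod (B $$ (i,j))) * vnorm x)"
    by (intro sum_mono) auto
  with vnorm_le_sum [of "B *\<^sub>v x"] show ?thesis
    using B by (simp add: sum_distrib_right)
qed

lemma opnorm_upper:
  assumes B: "B \<in> carrier_mat n m" and x: "x \<in> carrier_vec m"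
  shows "vnorm (B *\<^sub>v x) \<le> opnorm B * vnorm x"
proof (cases "vnorm x = 0")
  case True
  then show ?thesis using vnorm_mult_mat_vec_le [OF B x] by simp
next
  case False
  then have pos: "vnorm x > 0" using vnorm_nonneg [of x] by linarith
  define y where "y = complex_of_real (1 / vnorm x) \<cdot>\<^sub>v x"
  have y: "y \<in> carrier_vec m" "vnorm y = 1"
    using x pos by (auto simp: y_def vnorm_smult norm_divide)
  have "B *\<^sub>v y = complex_of_real (1 / vnorm x) \<cdot>\<^sub>v (B *\<^sub>v x)"
    unfolding y_def using B x by (rule mult_mat_vec)
  then have "vnorm (B *\<^sub>v y) = vnorm (B *\<^sub>v x) / vnorm x"
    using pos by (simp add: vnorm_smult norm_divide)
  moreover have "vnorm (B *\<^sub>v y) \<le> opnorm B"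
    unfolding opnorm_def
  proof (rule cSup_upper)
    show "bdd_above {vnorm (B *\<^sub>v x) |x. x \<in> carrier_vec (dim_col B) \<and> vnorm x = 1}"
      using vnorm_mult_mat_vec_le [OF B] B
      by (intro bdd_aboveI [of _ "\<Sum>i<n. \<Sum>j<m. cmod (B $$ (i,j))"]) fastforce
  qed (use B y in auto)
  ultimately have "vnorm (B *\<^sub>v x) / vnorm x \<le> opnorm B" by simp
  then show ?thesis using pos by (simp add: pos_divide_le_eq)
qed

text \<open>The hypothesis \<open>m > 0\<close> provides a unit vector; the supremum of an empty set
  of reals would carry no information.\<close>

lemma opnorm_least:
  assumes "B \<in> carrier_mat n m" "m > 0"
    and "\<And>x. x \<in> carrier_vec m \<Longrightarrow> vnorm x = 1 \<Longrightarrow> vnorm (B *\<^sub>v x) \<le> c"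
  shows "opnorm B \<le> c"
  unfolding opnorm_def
proof (rule cSup_least)
  show "{vnorm (B *\<^sub>v x) |x. x \<in> carrier_vec (dim_col B) \<and> vnorm x = 1} \<noteq> {}"
    using assms(1,2) vnorm_unit_vec [of 0 m] by (auto intro!: exI [of _ "unit_vec m 0"])
qed (use assms in auto)

lemma cmod_entry_le_opnorm:
  assumes B: "B \<in> carrier_mat n m" and "i < n" "j < m"
  shows "cmod (B $$ (i,j)) \<le> opnorm B"
proof -
  have "B *\<^sub>v unit_vec m j = col B j"
    using B \<open>j < m\<close> by (intro eq_vecI) auto
  then have "cmod (B $$ (i,j)) \<le> vnorm (B *\<^sub>v unit_vec m j)"
    using cmod_le_vnorm [of i "col B j"] assms by auto
  also have "\<dots> \<le> opnorm B"
    using opnorm_upper [OF B, of "unit_vec m j"] assms by (simp add: vnorm_unit_vec)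
  finally show ?thesis .
qed

section \<open>Adjoints and unitary matrices\<close>

lemma mat_adjoint_carrier [simp]: "A \<in> carrier_mat n m \<Longrightarrow> mat_adjoint A \<in> carrier_mat m n"
  by (auto simp: mat_adjoint_def)

lemma mat_adjoint_dim [simp]:
  "dim_row (mat_adjoint A) = dim_col A" "dim_col (mat_adjoint A) = dim_row A"
  by (simp_all add: mat_adjoint_def)

lemma mat_adjoint_index:
  "A \<in> carrier_mat n m \<Longrightarrow> i < m \<Longrightarrow> j < n \<Longrightarrow> mat_adjoint A $$ (i,j) = cnj (A $$ (j,i))"
  by (simp add: mat_adjoint_def mat_of_rows_index)

text \<open>One identity suffices because the matrix is square; \<open>unitary_mat_right\<close>
  supplies the other.\<close>

definition unitary_mat :: "nat \<Rightarrow> complex mat \<Rightarrow> bool" where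
  "unitary_mat n U \<longleftrightarrow> U \<in> carrier_mat n n \<and> mat_adjoint U * U = 1\<^sub>m n"

lemma unitary_mat_carrier: "unitary_mat n U \<Longrightarrow> U \<in> carrier_mat n n"
  by (simp add: unitary_mat_def)

lemma unitary_mat_right: "unitary_mat n U \<Longrightarrow> U * mat_adjoint U = 1\<^sub>m n"
  unfolding unitary_mat_def by (metis mat_adjoint_carrier mat_mult_left_right_inverse)

text \<open>Orthonormality of the columns, written entry by entry so that it can be checked on a
  constructed matrix and passed to an entrywise limit.\<close>

lemma unitary_mat_iff:
  assumes "U \<in> carrier_mat n n"
  shows "unitary_mat n U \<longleftrightarrow>
    (\<forall>i<n. \<forall>j<n. (\<Sum>k<n. cnj (U $$ (k,i)) * U $$ (k,j)) = (if i = j then 1 else 0))"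
proof -
  have e: "(mat_adjoint U * U) $$ (i,j) = (\<Sum>k<n. cnj (U $$ (k,i)) * U $$ (k,j))"
    if "i < n" "j < n" for i j
    using assms that by (subst mult_mat_sum) (auto simp: mat_adjoint_index intro!: sum.cong)
  have c: "mat_adjoint U * U \<in> carrier_mat n n"
    using assms by (auto intro!: mult_carrier_mat)
  have "mat_adjoint U * U = 1\<^sub>m n \<longleftrightarrow>
      (\<forall>i<n. \<forall>j<n. (mat_adjoint U * U) $$ (i,j) = 1\<^sub>m n $$ (i,j))"
    using c by (auto intro!: eq_matI)
  then show ?thesis using assms e by (auto simp: unitary_mat_def)
qed

lemma cinner_adjoint:
  assumes A: "A \<in> carrier_mat n m" and x: "x \<in> carrier_vec m" and y: "y \<in> carrier_vec n"
  shows "cinner (A *\<^sub>v x) y = cinner x (mat_adjoint A *\<^sub>v y)"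
proof -
  have "cinner (A *\<^sub>v x) y = (\<Sum>i<n. \<Sum>j<m. A $$ (i,j) * x $ j * cnj (y $ i))"
    using y by (simp add: cinner_def mult_mat_vec_sum [OF A x] sum_distrib_right del: index_mult_mat_vec)
  also have "\<dots> = (\<Sum>j<m. \<Sum>i<n. A $$ (i,j) * x $ j * cnj (y $ i))"
    by (rule sum.swap)
  also have "\<dots> = (\<Sum>j<m. x $ j * cnj (\<Sum>i<n. mat_adjoint A $$ (j,i) * y $ i))"
    by (simp add: sum_distrib_left mat_adjoint_index [OF A] mult_ac)
  also have "\<dots> = (\<Sum>j<m. x $ j * cnj ((mat_adjoint A *\<^sub>v y) $ j))"
    by (simp add: mult_mat_vec_sum [OF mat_adjoint_carrier [OF A] y] del: index_mult_mat_vec)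
  also have "\<dots> = cinner x (mat_adjoint A *\<^sub>v y)"
    using mat_adjoint_carrier [OF A] by (auto simp: cinner_def simp del: index_mult_mat_vec)
  finally show ?thesis .
qed

lemma mat_adjoint_mat_adjoint: "mat_adjoint (mat_adjoint A) = (A :: complex mat)"
proof (rule eq_matI)
  have A: "A \<in> carrier_mat (dim_row A) (dim_col A)" by auto
  note A' = mat_adjoint_carrier [OF A]
  show "dim_row (mat_adjoint (mat_adjoint A)) = dim_row A"
    "dim_col (mat_adjoint (mat_adjoint A)) = dim_col A"
    using mat_adjoint_carrier [OF A'] unfolding carrier_mat_def by simp_all
  fix i j assume "i < dim_row A" "j < dim_col A"
  then show "mat_adjoint (mat_adjoint A) $$ (i,j) = A $$ (i,j)"
    by (simp add: mat_adjoint_index [OF A'] mat_adjoint_index [OF A])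
qed

lemma unitary_mat_adjoint: "unitary_mat n U \<Longrightarrow> unitary_mat n (mat_adjoint U)"
  using unitary_mat_right [of n U] by (auto simp: unitary_mat_def mat_adjoint_mat_adjoint)

lemma vnorm_unitary:
  assumes U: "unitary_mat n U" and x: "x \<in> carrier_vec n"
  shows "vnorm (U *\<^sub>v x) = vnorm x"
proof -
  have Uc: "U \<in> carrier_mat n n" using U by (rule unitary_mat_carrier)
  have "mat_adjoint U *\<^sub>v (U *\<^sub>v x) = (mat_adjoint U * U) *\<^sub>v x"
    using mat_adjoint_carrier [OF Uc] Uc x by (rule assoc_mult_mat_vec [symmetric])
  then have "mat_adjoint U *\<^sub>v (U *\<^sub>v x) = x"
    using U x by (simp add: unitary_mat_def)
  then have "cinner (U *\<^sub>v x) (U *\<^sub>v x) = cinner x x"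
    using cinner_adjoint [OF Uc x, of "U *\<^sub>v x"] Uc x by simp
  then have "(vnorm (U *\<^sub>v x))\<^sup>2 = (vnorm x)\<^sup>2"
    by (metis vnorm_sq_cinner of_real_eq_iff)
  then show ?thesis by simp
qed

text \<open>The adjoint of \<open>U\<close> maps the unit sphere onto itself, so reparametrizing by
  it carries the defining sets of \<open>opnorm\<close> and \<open>num_range\<close> for
  \<open>M\<close> onto those for the conjugated matrix.\<close>

lemma
  assumes U: "unitary_mat n U" and M: "M \<in> carrier_mat n n"
  shows opnorm_unitary: "opnorm (U * M * mat_adjoint U) = opnorm M"
    and num_range_unitary: "num_range (U * M * mat_adjoint U) = num_range M"
proof -
  define V where "V = mat_adjoint U"
  have V: "unitary_mat n V" using unitary_mat_adjoint [OF U] by (simp add: V_def)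
  have Uc: "U \<in> carrier_mat n n" and Vc: "V \<in> carrier_mat n n"
    using U V by (auto intro: unitary_mat_carrier)
  have mv: "(U * M * V) *\<^sub>v x = U *\<^sub>v (M *\<^sub>v (V *\<^sub>v x))" if "x \<in> carrier_vec n" for x
    using mult_mat_vec_assoc3 [OF Uc M Vc that] .
  have bij: "V *\<^sub>v (U *\<^sub>v x) = x" if "x \<in> carrier_vec n" for x
  proof -
    have "V *\<^sub>v (U *\<^sub>v x) = (V * U) *\<^sub>v x" using Uc Vc that by simp
    then show ?thesis using U that by (simp add: V_def unitary_mat_def)
  qed
  have surj: "{x. x \<in> carrier_vec n \<and> vnorm x = 1} = (\<lambda>x. V *\<^sub>v x) ` {x. x \<in> carrier_vec n \<and> vnorm x = 1}"
  proof (rule equalityI; rule subsetI)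
    fix x assume "x \<in> {x. x \<in> carrier_vec n \<and> vnorm x = 1}"
    then show "x \<in> (\<lambda>x. V *\<^sub>v x) ` {x. x \<in> carrier_vec n \<and> vnorm x = 1}"
      using bij [of x] vnorm_unitary [OF U, of x] Uc
      by (intro image_eqI [of _ _ "U *\<^sub>v x"]) auto
  next
    fix y assume "y \<in> (\<lambda>x. V *\<^sub>v x) ` {x. x \<in> carrier_vec n \<and> vnorm x = 1}"
    then show "y \<in> {x. x \<in> carrier_vec n \<and> vnorm x = 1}"
      using vnorm_unitary [OF V] Vc by auto
  qed
  have image_surj: "f ` {x. x \<in> carrier_vec n \<and> vnorm x = 1} =
      (\<lambda>x. f (V *\<^sub>v x)) ` {x. x \<in> carrier_vec n \<and> vnorm x = 1}" for f :: "complex vec \<Rightarrow> 'c"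
    using arg_cong [OF surj, of "image f"] unfolding image_image .
  have image: "{f x |x. x \<in> carrier_vec k \<and> vnorm x = 1} = f ` {x. x \<in> carrier_vec k \<and> vnorm x = 1}"
    for k and f :: "complex vec \<Rightarrow> 'b" by auto
  have "vnorm ((U * M * V) *\<^sub>v x) = vnorm (M *\<^sub>v (V *\<^sub>v x))" if "x \<in> carrier_vec n" for x
    unfolding mv [OF that] using M Vc that by (intro vnorm_unitary [OF U]) auto
  then have "(\<lambda>x. vnorm ((U * M * V) *\<^sub>v x)) ` {x. x \<in> carrier_vec n \<and> vnorm x = 1} =
      (\<lambda>x. vnorm (M *\<^sub>v x)) ` {x. x \<in> carrier_vec n \<and> vnorm x = 1}"
    unfolding image_surj [of "\<lambda>x. vnorm (M *\<^sub>v x)"] by (intro image_cong) auto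
  then show "opnorm (U * M * mat_adjoint U) = opnorm M"
    using Uc M Vc unfolding opnorm_def image V_def [symmetric] by simp
  have "cinner ((U * M * V) *\<^sub>v x) x = cinner (M *\<^sub>v (V *\<^sub>v x)) (V *\<^sub>v x)" if "x \<in> carrier_vec n" for x
    unfolding mv [OF that] using cinner_adjoint [OF Uc, folded V_def] M Vc that by auto
  then have "(\<lambda>x. cinner ((U * M * V) *\<^sub>v x) x) ` {x. x \<in> carrier_vec n \<and> vnorm x = 1} =
      (\<lambda>x. cinner (M *\<^sub>v x) x) ` {x. x \<in> carrier_vec n \<and> vnorm x = 1}"
    unfolding image_surj [of "\<lambda>x. cinner (M *\<^sub>v x) x"] by (intro image_cong) auto
  then show "num_range (U * M * mat_adjoint U) = num_range M"
    using Uc M Vc unfolding num_range_def image V_def [symmetric] by simp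
qed

section \<open>Polynomials of a matrix\<close>

lemma poly_mat_carrier [simp]: "B \<in> carrier_mat n n \<Longrightarrow> poly_mat p B \<in> carrier_mat n n"
  by (auto simp: poly_mat_def)

lemma poly_mat_index:
  "B \<in> carrier_mat n n \<Longrightarrow> i < n \<Longrightarrow> j < n \<Longrightarrow>
    poly_mat p B $$ (i,j) = (\<Sum>k\<le>degree p. coeff p k * (B ^\<^sub>m k) $$ (i,j))"
  by (auto simp: poly_mat_def)

text \<open>The relation \<open>A * X = X * B\<close> passes to powers by induction and then to
  polynomials by linearity. With \<open>X\<close> unitary this yields compatibility with unitary
  similarity; with all three matrices equal it says that a matrix commutes with its own
  polynomials.\<close>

lemma poly_mat_intertwine:
  assumes A: "A \<in> carrier_mat n n" and B: "B \<in> carrier_mat n n" and X: "X \<in> carrier_mat n n"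
    and AX: "A * X = X * B"
  shows "poly_mat p A * X = X * poly_mat p B"
proof -
  have pow: "A ^\<^sub>m k * X = X * B ^\<^sub>m k" for k
  proof (induction k)
    case 0
    then show ?case using A B X by simp
  next
    case (Suc k)
    have "A ^\<^sub>m Suc k * X = A ^\<^sub>m k * (A * X)"
      using A X by (simp add: assoc_mult_mat [of _ n n _ n _ n])
    also have "\<dots> = (A ^\<^sub>m k * X) * B"
      unfolding AX using A B X by (simp add: assoc_mult_mat [of _ n n _ n _ n])
    also have "\<dots> = X * B ^\<^sub>m Suc k"
      unfolding Suc using A B X by (simp add: assoc_mult_mat [of _ n n _ n _ n])
    finally show ?case .
  qed
  have pA: "poly_mat p A \<in> carrier_mat n n" and pB: "poly_mat p B \<in> carrier_mat n n"
    using A B by auto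
  have "(poly_mat p A * X) $$ (i,j) = (X * poly_mat p B) $$ (i,j)" if ij: "i < n" "j < n" for i j
  proof -
    have "(poly_mat p A * X) $$ (i,j) =
        (\<Sum>m<n. \<Sum>k\<le>degree p. coeff p k * ((A ^\<^sub>m k) $$ (i,m) * X $$ (m,j)))"
      using ij by (simp add: mult_mat_sum [OF pA X] poly_mat_index [OF A] sum_distrib_right mult.assoc
          del: index_mult_mat)
    also have "\<dots> = (\<Sum>k\<le>degree p. coeff p k * (\<Sum>m<n. (A ^\<^sub>m k) $$ (i,m) * X $$ (m,j)))"
      by (subst sum.swap) (simp add: sum_distrib_left)
    also have "\<dots> = (\<Sum>k\<le>degree p. coeff p k * (A ^\<^sub>m k * X) $$ (i,j))"
      using ij by (simp add: mult_mat_sum [OF pow_carrier_mat [OF A] X] del: index_mult_mat)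
    also have "\<dots> = (\<Sum>k\<le>degree p. coeff p k * (X * B ^\<^sub>m k) $$ (i,j))"
      by (simp only: pow)
    also have "\<dots> = (\<Sum>k\<le>degree p. coeff p k * (\<Sum>m<n. X $$ (i,m) * (B ^\<^sub>m k) $$ (m,j)))"
      using ij by (simp add: mult_mat_sum [OF X pow_carrier_mat [OF B]] del: index_mult_mat)
    also have "\<dots> = (\<Sum>m<n. \<Sum>k\<le>degree p. X $$ (i,m) * (coeff p k * (B ^\<^sub>m k) $$ (m,j)))"
      by (subst sum.swap) (simp add: sum_distrib_left mult_ac)
    also have "\<dots> = (X * poly_mat p B) $$ (i,j)"
      using ij by (simp add: mult_mat_sum [OF X pB] poly_mat_index [OF B] sum_distrib_left
          del: index_mult_mat)
    finally show ?thesis .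
  qed
  moreover have "poly_mat p A * X \<in> carrier_mat n n" "X * poly_mat p B \<in> carrier_mat n n"
    using pA pB X by auto
  ultimately show ?thesis
    by (metis (no_types, lifting) carrier_matD eq_matI)
qed

lemma poly_mat_unitary:
  assumes U: "unitary_mat n U" and M: "M \<in> carrier_mat n n"
  shows "poly_mat p (U * M * mat_adjoint U) = U * poly_mat p M * mat_adjoint U"
proof -
  define V where "V = mat_adjoint U"
  have Uc: "U \<in> carrier_mat n n" and Vc: "V \<in> carrier_mat n n"
    and VU: "V * U = 1\<^sub>m n" and UV: "U * V = 1\<^sub>m n"
    using U unitary_mat_right [OF U] by (auto simp: unitary_mat_def V_def)
  let ?A = "U * M * V"
  have A: "?A \<in> carrier_mat n n" using Uc M Vc by auto
  have "?A * U = (U * M) * (V * U)"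
    using Uc M Vc by (intro assoc_mult_mat) auto
  then have "?A * U = U * M" using VU Uc M by simp
  from poly_mat_intertwine [OF A M Uc this]
  have "poly_mat p ?A * U = U * poly_mat p M" .
  then have "poly_mat p ?A * U * V = U * poly_mat p M * V" by simp
  moreover have "poly_mat p ?A * U * V = poly_mat p ?A * (U * V)"
    using poly_mat_carrier [OF A] Uc Vc by (rule assoc_mult_mat)
  moreover have "poly_mat p ?A * (U * V) = poly_mat p ?A"
    unfolding UV using poly_mat_carrier [OF A] by (rule right_mult_one_mat)
  ultimately show ?thesis by (metis V_def)
qed

subsection \<open>Unitary triangularization\<close>

lemma cinner_eq_cscalar_prod: "cinner u v = u \<bullet>c v"
  by (simp add: cinner_def scalar_prod_def lessThan_atLeast0)

lemma mat_adjoint_mult: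
  fixes A B :: "complex mat"
  assumes A: "A \<in> carrier_mat n m" and B: "B \<in> carrier_mat m l"
  shows "mat_adjoint (A * B) = mat_adjoint B * mat_adjoint A"
proof -
  have AB: "A * B \<in> carrier_mat n l" using A B by (rule mult_carrier_mat)
  note A' = mat_adjoint_carrier [OF A] and B' = mat_adjoint_carrier [OF B]
  have BA': "mat_adjoint B * mat_adjoint A \<in> carrier_mat l n" using B' A' by (rule mult_carrier_mat)
  have "mat_adjoint (A * B) $$ (i,j) = (mat_adjoint B * mat_adjoint A) $$ (i,j)"
    if "i < l" "j < n" for i j
    unfolding mat_adjoint_index [OF AB that] mult_mat_sum [OF A B that(2,1)] mult_mat_sum [OF B' A' that]
    using that by (auto simp: mat_adjoint_index [OF A] mat_adjoint_index [OF B] mult_ac intro!: sum.cong)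
  then show ?thesis
    using mat_adjoint_carrier [OF AB] BA'
    by (metis (no_types, lifting) carrier_matD eq_matI)
qed

lemma unitary_mat_mult:
  assumes U: "unitary_mat n U" and V: "unitary_mat n V"
  shows "unitary_mat n (U * V)"
proof -
  have Uc: "U \<in> carrier_mat n n" and Vc: "V \<in> carrier_mat n n"
    using U V by (auto intro: unitary_mat_carrier)
  note U' = mat_adjoint_carrier [OF Uc] and V' = mat_adjoint_carrier [OF Vc]
  have "mat_adjoint (U * V) * (U * V) = mat_adjoint V * (mat_adjoint U * (U * V))"
    unfolding mat_adjoint_mult [OF Uc Vc] using V' U' mult_carrier_mat [OF Uc Vc] by (rule assoc_mult_mat)
  also have "mat_adjoint U * (U * V) = mat_adjoint U * U * V"
    using assoc_mult_mat [OF U' Uc Vc] by simp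
  also have "\<dots> = V" using U Vc by (simp add: unitary_mat_def)
  finally show ?thesis using V mult_carrier_mat [OF Uc Vc] by (simp add: unitary_mat_def)
qed

lemma unitary_similar_sym:
  assumes U: "unitary_mat n U" and A: "A \<in> carrier_mat n n"
  shows "A = U * (mat_adjoint U * A * U) * mat_adjoint U"
proof -
  define V where "V = mat_adjoint U"
  have Uc: "U \<in> carrier_mat n n" and Vc: "V \<in> carrier_mat n n" and UV: "U * V = 1\<^sub>m n"
    using U unitary_mat_right [OF U] by (auto simp: unitary_mat_def V_def)
  have "U * (V * A * U) * V = U * (V * A * U * V)"
    using Uc Vc A by (intro assoc_mult_mat [of _ n n _ n _ n]) auto
  also have "V * A * U * V = V * A * (U * V)"
    using Uc Vc A by (intro assoc_mult_mat [of _ n n _ n _ n]) auto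
  also have "\<dots> = V * A"
    unfolding UV using mult_carrier_mat [OF Vc A] by (rule right_mult_one_mat)
  also have "U * (V * A) = U * V * A"
    using Uc Vc A by (intro assoc_mult_mat [of _ n n _ n _ n, symmetric]) auto
  also have "\<dots> = A" unfolding UV using A by (rule left_mult_one_mat)
  finally show ?thesis by (simp add: V_def)
qed

text \<open>Extend \<open>v\<close> to a basis, apply Gram-Schmidt, which keeps the first vector,
  and normalize the columns; since \<open>v\<close> has norm 1, it survives the
  normalization.\<close>

lemma unitary_completion:
  assumes v: "v \<in> carrier_vec n" and v1: "vnorm v = 1"
  obtains U where "unitary_mat n U" "col U 0 = v"
proof -
  have n: "n > 0"
  proof (rule ccontr)
    assume "\<not> n > 0"
    then have "vnorm v = 0" using v by (simp add: vnorm_def)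
    then show False using v1 by simp
  qed
  have v0: "v \<noteq> 0\<^sub>v n" using v1 vnorm_zero_iff [OF v] by auto
  interpret cof_vec_space n "TYPE(complex)" .
  define b where "b = basis_completion v"
  from basis_completion[OF v v0, folded b_def]
  have dist_b: "distinct b" and indep: "\<not> lin_dep (set b)" and b: "set b \<subseteq> carrier_vec n"
    and hdb: "hd b = v" and len_b: "length b = n" by auto
  from hdb len_b n obtain vs where bv: "b = v # vs" by (cases b, auto)
  define ws where "ws = gram_schmidt n b"
  from gram_schmidt_result[OF b dist_b indep refl, folded ws_def]
  have ws: "set ws \<subseteq> carrier_vec n" "corthogonal ws" "length ws = n"
    by (auto simp: len_b)
  from gram_schmidt_hd[OF v, of vs, folded bv] have "hd ws = v" unfolding ws_def .
  then have ws0: "ws ! 0 = v" using ws n by (metis hd_conv_nth list.size(3) less_irrefl)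
  have wsc: "ws ! j \<in> carrier_vec n" if "j < n" for j using ws that by auto
  define U where "U = mat n n (\<lambda>(i,j). (ws ! j) $ i / complex_of_real (vnorm (ws ! j)))"
  have Uc: "U \<in> carrier_mat n n" by (simp add: U_def)
  have "(\<Sum>k<n. cnj (U $$ (k,i)) * U $$ (k,j)) = (if i = j then 1 else 0)" if ij: "i < n" "j < n" for i j
  proof -
    have "(\<Sum>k<n. cnj (U $$ (k,i)) * U $$ (k,j)) =
        cinner (ws ! j) (ws ! i) / (complex_of_real (vnorm (ws ! i)) * complex_of_real (vnorm (ws ! j)))"
      using ij carrier_vecD [OF wsc [OF ij(1)]] by (simp add: U_def cinner_def sum_divide_distrib mult_ac)
    also have "\<dots> = (if i = j then 1 else 0)"
    proof (cases "i = j")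
      case True
      have "cinner (ws ! i) (ws ! i) \<noteq> 0"
        using corthogonalD [OF ws(2), of i i] ij ws by (simp add: cinner_eq_cscalar_prod)
      then show ?thesis using True
        by (simp add: vnorm_sq_cinner [symmetric] power2_eq_square)
    next
      case False
      then have "cinner (ws ! j) (ws ! i) = 0"
        using corthogonalD [OF ws(2), of j i] ij ws by (simp add: cinner_eq_cscalar_prod)
      then show ?thesis using False by simp
    qed
    finally show ?thesis .
  qed
  then have "unitary_mat n U" using unitary_mat_iff [OF Uc] by simp
  moreover have "col U 0 = v"
    using n v v1 by (intro eq_vecI) (auto simp: U_def ws0)
  ultimately show ?thesis by (rule that)
qed

text \<open>Schur triangularization by deflation: split off an eigenvector for the first listed root
  and continue with the trailing block. Prescribing \<open>es\<close> allows any order of the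
  eigenvalues on the diagonal.\<close>

lemma unitary_schur:
  fixes A :: "complex mat"
  assumes "A \<in> carrier_mat n n" and "char_poly A = (\<Prod>e\<leftarrow>es. [:- e, 1:])"
  shows "\<exists>U. unitary_mat n U \<and> upper_triangular (mat_adjoint U * A * U) \<and>
    diag_mat (mat_adjoint U * A * U) = es"
  using assms
proof (induction es arbitrary: n A)
  case Nil
  \<comment> \<open>The empty product has degree 0, while the characteristic polynomial has degree
    \<open>n\<close>.\<close>
  then have "n = 0" using degree_monic_char_poly [of A n] by auto
  then have "unitary_mat n (1\<^sub>m n)" by (auto simp: unitary_mat_iff)
  then show ?case
    using Nil \<open>n = 0\<close> by (intro exI [of _ "1\<^sub>m n"]) (auto simp: diag_mat_def mat_adjoint_def)
next
  case (Cons e es)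
  note A = Cons.prems(1)
  have cp: "char_poly A = [:- e, 1:] * (\<Prod>e\<leftarrow>es. [:- e, 1:])" using Cons.prems(2) by simp
  have ev: "eigenvalue A e" unfolding eigenvalue_root_char_poly [OF A] cp by simp
  then obtain w where w: "w \<in> carrier_vec n" "w \<noteq> 0\<^sub>v n" "A *\<^sub>v w = e \<cdot>\<^sub>v w"
    using A by (auto simp: eigenvalue_def eigenvector_def)
  define v where "v = complex_of_real (1 / vnorm w) \<cdot>\<^sub>v w"
  have w0: "vnorm w \<noteq> 0" using w vnorm_zero_iff by blast
  have v: "v \<in> carrier_vec n" and v1: "vnorm v = 1"
    using w w0 by (auto simp: v_def vnorm_smult norm_divide)
  have Av: "A *\<^sub>v v = e \<cdot>\<^sub>v v"
    unfolding v_def using A w by (simp add: mult_mat_vec smult_smult_assoc mult.commute)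
  obtain U where U: "unitary_mat n U" and U0: "col U 0 = v"
    using unitary_completion [OF v v1] .
  have Uc: "U \<in> carrier_mat n n" using U by (rule unitary_mat_carrier)
  note U' = mat_adjoint_carrier [OF Uc]
  have n: "n > 0" using w vnorm_zero_iff [OF w(1)] w0 by (cases n) auto
  then obtain m where m: "n = Suc m" by (cases n) auto
  define B where "B = mat_adjoint U * A * U"
  have B: "B \<in> carrier_mat n n" unfolding B_def using mult_carrier_mat [OF mult_carrier_mat [OF U' A] Uc] .
  \<comment> \<open>The first column of \<open>U\<close> is the eigenvector \<open>v\<close>, so
    \<open>B\<close> maps the first unit vector to \<open>e\<close> times itself.\<close>
  have Bcol: "B $$ (i,0) = (if i = 0 then e else 0)" if i: "i < n" for i
  proof -
    have "B *\<^sub>v unit_vec n 0 = mat_adjoint U *\<^sub>v (A *\<^sub>v (U *\<^sub>v unit_vec n 0))"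
      unfolding B_def by (rule mult_mat_vec_assoc3 [OF U' A Uc]) simp
    also have "U *\<^sub>v unit_vec n 0 = v"
      using Uc n U0 by (auto intro!: eq_vecI)
    also have "mat_adjoint U *\<^sub>v (A *\<^sub>v v) = e \<cdot>\<^sub>v (mat_adjoint U *\<^sub>v v)"
      unfolding Av using U' v by (rule mult_mat_vec)
    also have "mat_adjoint U *\<^sub>v v = mat_adjoint U *\<^sub>v (U *\<^sub>v unit_vec n 0)"
      using Uc n U0 by (auto intro!: arg_cong [of _ _ "\<lambda>x. mat_adjoint U *\<^sub>v x"] eq_vecI)
    also have "\<dots> = (mat_adjoint U * U) *\<^sub>v unit_vec n 0"
      by (rule assoc_mult_mat_vec [OF U' Uc, symmetric]) simp
    also have "\<dots> = unit_vec n 0"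
      using U by (simp add: unitary_mat_def)
    finally have "(B *\<^sub>v unit_vec n 0) $ i = (e \<cdot>\<^sub>v unit_vec n 0) $ i" by simp
    moreover have "(B *\<^sub>v unit_vec n 0) $ i = B $$ (i,0)"
      using B n i by auto
    ultimately show ?thesis using i by (auto simp: unit_vec_def split: if_splits)
  qed
  define A1 where "A1 = mat 1 1 (\<lambda>_. e)"
  define A2 where "A2 = mat 1 m (\<lambda>(i,j). B $$ (0, Suc j))"
  define A3 where "A3 = mat m m (\<lambda>(i,j). B $$ (Suc i, Suc j))"
  have A1: "A1 \<in> carrier_mat 1 1" and A2: "A2 \<in> carrier_mat 1 m" and A3: "A3 \<in> carrier_mat m m"
    by (auto simp: A1_def A2_def A3_def)
  have Bblock: "B = four_block_mat A1 A2 (0\<^sub>m m 1) A3"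
    using B Bcol m by (intro eq_matI) (auto simp: A1_def A2_def A3_def)
  have "similar_mat A B"
    unfolding similar_mat_def
  proof (intro exI)
    show "similar_mat_wit A B U (mat_adjoint U)"
      using U unitary_mat_right [OF U] unitary_similar_sym [OF U A, folded B_def]
      unfolding unitary_mat_def by (intro similar_mat_witI [of _ _ n, OF _ _ _ A B Uc U']) blast+
  qed
  then have "char_poly A = char_poly B" by (rule char_poly_similar)
  also have "\<dots> = char_poly A1 * char_poly A3"
    unfolding Bblock by (rule char_poly_four_block_zeros_col [OF A1 A2 A3])
  also have "char_poly A1 = [:-e, 1:]"
    by (simp add: A1_def char_poly_defs det_def sign_def)
  \<comment> \<open>Cancelling the factor of \<open>e\<close> leaves exactly the roots
    \<open>es\<close> for the trailing block, as the induction hypothesis requires.\<close>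
  finally have "char_poly A3 = (\<Prod>e\<leftarrow>es. [:- e, 1:])"
    unfolding cp by (metis mult_cancel_left pCons_eq_0_iff zero_neq_one)
  from Cons.IH [OF A3 this] obtain V where V: "unitary_mat m V"
    and ut: "upper_triangular (mat_adjoint V * A3 * V)" and dg: "diag_mat (mat_adjoint V * A3 * V) = es"
    by blast
  have Vc: "V \<in> carrier_mat m m" using V by (rule unitary_mat_carrier)
  note V' = mat_adjoint_carrier [OF Vc]
  \<comment> \<open>Acting by \<open>V\<close> on the trailing coordinates alone keeps the first
    column of \<open>B\<close> and triangularizes the rest.\<close>
  define W where "W = four_block_mat (1\<^sub>m 1) (0\<^sub>m 1 m) (0\<^sub>m m 1) V"
  define W' where "W' = four_block_mat (1\<^sub>m 1) (0\<^sub>m 1 m) (0\<^sub>m m 1) (mat_adjoint V)"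
  have Wc: "W \<in> carrier_mat n n" and W'c: "W' \<in> carrier_mat n n"
    using four_block_carrier_mat [OF one_carrier_mat [of 1] Vc]
      four_block_carrier_mat [OF one_carrier_mat [of 1] V'] m
    unfolding W_def W'_def by simp_all
  have adjW: "mat_adjoint W = W'"
  proof (rule eq_matI)
    fix i j assume "i < dim_row W'" "j < dim_col W'"
    then have ij: "i < n" "j < n" using W'c by auto
    show "mat_adjoint W $$ (i,j) = W' $$ (i,j)"
      unfolding mat_adjoint_index [OF Wc ij] using ij m Vc
      by (cases i; cases j) (auto simp: W_def W'_def mat_adjoint_index [OF Vc])
  qed (use Wc W'c in auto)
  have "W' * W = four_block_mat (1\<^sub>m 1) (0\<^sub>m 1 m) (0\<^sub>m m 1) (mat_adjoint V * V)"
    unfolding W_def W'_def using Vc V' by (subst mult_four_block_mat [of _ 1 1 _ m _ m _ _ 1 _ m]) auto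
  then have W: "unitary_mat n W"
    using V Wc m by (simp add: unitary_mat_def adjW)
  define T where "T = W' * B * W"
  have W'B: "W' * B = four_block_mat A1 A2 (0\<^sub>m m 1) (mat_adjoint V * A3)"
    unfolding Bblock W'_def using Vc V' A1 A2 A3
    by (subst mult_four_block_mat [of _ 1 1 _ m _ m _ _ 1 _ m]) auto
  have T: "T = four_block_mat A1 (A2 * V) (0\<^sub>m m 1) (mat_adjoint V * A3 * V)"
    unfolding T_def W'B unfolding W_def using Vc A1 A2 mult_carrier_mat [OF V' A3]
    by (subst mult_four_block_mat [of _ 1 1 _ m _ m _ _ 1 _ m]) auto
  have ut1: "upper_triangular A1" by (auto simp: A1_def)
  have VAV: "mat_adjoint V * A3 * V \<in> carrier_mat m m" using mult_carrier_mat [OF mult_carrier_mat [OF V' A3] Vc] .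
  have "upper_triangular T"
    unfolding T by (rule upper_triangular_four_block [OF A1 VAV ut1 ut])
  moreover have "diag_mat T = e # es"
    unfolding T using diag_four_block_mat [OF A1 VAV] dg by (auto simp: A1_def diag_mat_def)
  moreover have "unitary_mat n (U * W)" using U W by (rule unitary_mat_mult)
  moreover have "mat_adjoint (U * W) * A * (U * W) = T"
  proof -
    have "mat_adjoint (U * W) * A * (U * W) = W' * mat_adjoint U * A * (U * W)"
      by (simp add: mat_adjoint_mult [OF Uc Wc] adjW)
    also have "\<dots> = W' * (mat_adjoint U * A) * (U * W)"
      using assoc_mult_mat [OF W'c U' A] by simp
    also have "\<dots> = W' * ((mat_adjoint U * A) * (U * W))"
      using W'c mult_carrier_mat [OF U' A] mult_carrier_mat [OF Uc Wc] by (rule assoc_mult_mat)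
    also have "(mat_adjoint U * A) * (U * W) = B * W"
      unfolding B_def using assoc_mult_mat [OF mult_carrier_mat [OF U' A] Uc Wc] by simp
    also have "W' * (B * W) = T"
      unfolding T_def using assoc_mult_mat [OF W'c B Wc] by simp
    finally show ?thesis .
  qed
  ultimately show ?case by metis
qed

text \<open>Sorting the roots by \<open>f\<close> before triangularizing leaves the product of the
  linear factors unchanged. With \<open>f\<close> the distance to an eigenvalue, all its copies come
  first on the diagonal.\<close>

lemma unitary_schur_sorted:
  fixes A :: "complex mat" and f :: "complex \<Rightarrow> real"
  assumes A: "A \<in> carrier_mat n n"
  obtains U where "unitary_mat n U" "upper_triangular (mat_adjoint U * A * U)"
    "\<And>i j. i \<le> j \<Longrightarrow> j < n \<Longrightarrow>
      f ((mat_adjoint U * A * U) $$ (i,i)) \<le> f ((mat_adjoint U * A * U) $$ (j,j))"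
proof -
  obtain as where as: "char_poly A = (\<Prod>e\<leftarrow>as. [:- e, 1:])" "length as = n"
    using char_poly_factorized [OF A] by auto
  define es where "es = sort_key f as"
  have "prod_list (map (\<lambda>e. [:- e, 1:]) es) = prod_list (map (\<lambda>e. [:- e, 1:]) as)"
    unfolding es_def by (simp flip: prod_mset_prod_list)
  then have "char_poly A = (\<Prod>e\<leftarrow>es. [:- e, 1:])" using as by simp
  then obtain U where U: "unitary_mat n U" "upper_triangular (mat_adjoint U * A * U)"
    "diag_mat (mat_adjoint U * A * U) = es"
    using unitary_schur [OF A] by blast
  define T where "T = mat_adjoint U * A * U"
  have Uc: "U \<in> carrier_mat n n" using U by (auto intro: unitary_mat_carrier)
  then have "T \<in> carrier_mat n n"
    unfolding T_def using mult_carrier_mat [OF mult_carrier_mat [OF mat_adjoint_carrier A]] by blast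
  then have diag: "es ! i = T $$ (i,i)" if "i < n" for i
    using U(3) that by (auto simp: T_def [symmetric] diag_mat_def)
  have sorted: "sorted (map f es)" by (simp add: es_def)
  have "f (T $$ (i,i)) \<le> f (T $$ (j,j))" if "i \<le> j" "j < n" for i j
    using sorted_nth_mono [OF sorted that(1)] that as diag [of i] diag [of j] by (simp add: es_def)
  then show ?thesis using that U by (simp add: T_def)
qed

subsection \<open>Boundary eigenvalues are reducing\<close>

lemma sum_two_points:
  fixes f :: "nat \<Rightarrow> 'a::comm_ring"
  assumes "j < n" "m < n" "j \<noteq> m"
  shows "(\<Sum>i<n. f i * (if i = j then b else if i = m then c else 0)) = f j * b + f m * c"
proof -
  have "(\<Sum>i<n. f i * (if i = j then b else if i = m then c else 0)) =
      (\<Sum>i<n. (if i = j then f j * b else 0) + (if i = m then f m * c else 0))"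
    using assms by (intro sum.cong) auto
  then show ?thesis using assms by (simp add: sum.distrib)
qed

text \<open>The point of the numerical range given by the unit vector with entry \<open>r\<close> at \<open>j\<close> and \<open>s u\<close> at \<open>m\<close>.\<close>

lemma num_range_two_coords:
  fixes T :: "complex mat" and r s :: real
  assumes T: "T \<in> carrier_mat n n" and j: "j < n" and m: "m < n" and jm: "j \<noteq> m"
    and col: "T $$ (j,j) = l" "T $$ (m,j) = 0"
    and rs: "r\<^sup>2 + s\<^sup>2 = 1" and u: "cmod u = 1"
  shows "l + s\<^sup>2 * (T $$ (m,m) - l) + T $$ (j,m) * (r * s) * u \<in> num_range T"
proof -
  define x where "x = vec n (\<lambda>i. if i = j then complex_of_real r else if i = m then complex_of_real s * u else 0)"
  have x: "x \<in> carrier_vec n" by (simp add: x_def)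
  have "(vnorm x)\<^sup>2 = (\<Sum>i<n. 1 * (if i = j then r\<^sup>2 else if i = m then s\<^sup>2 else 0))"
    unfolding vnorm_sq using u by (intro sum.cong) (auto simp: x_def norm_mult)
  also have "\<dots> = 1" unfolding sum_two_points [OF j m jm] using rs by simp
  finally have "vnorm x = 1" using vnorm_nonneg [of x] by (simp add: power2_eq_1_iff)
  have Tx: "(T *\<^sub>v x) $ i = T $$ (i,j) * r + T $$ (i,m) * (s * u)" if "i < n" for i
    using sum_two_points [OF j m jm, of "\<lambda>k. T $$ (i,k)" "complex_of_real r" "s * u"]
    unfolding mult_mat_vec_sum [OF T x that] by (simp add: x_def)
  have uu: "u * cnj u = 1" using u by (simp add: complex_norm_square [symmetric])
  have r2: "complex_of_real r * complex_of_real r = 1 - complex_of_real s * complex_of_real s"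
    using rs by (metis (no_types, lifting) eq_diff_eq of_real_1 of_real_diff of_real_mult power2_eq_square)
  have "cinner (T *\<^sub>v x) x = (\<Sum>i<n. (T *\<^sub>v x) $ i *
      (if i = j then complex_of_real r else if i = m then complex_of_real s * cnj u else 0))"
    unfolding cinner_def using x by (auto simp: x_def intro!: sum.cong)
  also have "\<dots> = (l * r + T $$ (j,m) * (s * u)) * r + (T $$ (m,m) * (s * u)) * (s * cnj u)"
    unfolding sum_two_points [OF j m jm] Tx [OF j] Tx [OF m] col by simp
  also have "\<dots> = l * (complex_of_real r * r) + T $$ (m,m) * (complex_of_real s * s) * (u * cnj u) +
      T $$ (j,m) * (r * s) * u"
    by (simp add: algebra_simps)
  also have "\<dots> = l + s\<^sup>2 * (T $$ (m,m) - l) + T $$ (j,m) * (r * s) * u"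
    unfolding uu r2 by (simp add: algebra_simps power2_eq_square)
  finally show ?thesis
    unfolding num_range_def using T x \<open>vnorm x = 1\<close> by force
qed

lemma boundary_eigenvalue_row:
  fixes T :: "complex mat"
  assumes T: "T \<in> carrier_mat n n" and j: "j < n" and m: "m < n" and jm: "j \<noteq> m"
    and col: "T $$ (j,j) = l" "T $$ (m,j) = 0"
    and l: "l \<in> frontier (num_range T)"
  shows "T $$ (j,m) = 0"
proof (rule ccontr)
  \<comment> \<open>Otherwise, a whole disc around \<open>l\<close> is reached: the size \<open>s\<close> of the \<open>m\<close>-th coordinate is found by
    the intermediate value theorem, its phase \<open>u\<close> then adjusts the argument.\<close>
  define a where "a = T $$ (j,m)"
  define d where "d = T $$ (m,m) - l"
  assume "T $$ (j,m) \<noteq> 0"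
  then have a: "cmod a > 0" by (simp add: a_def)
  \<comment> \<open>The bound 1/2 keeps \<open>sqrt (1 - s0\<^sup>2)\<close> at least 1/2, and the
    other bound keeps \<open>s0 * cmod d\<close> at most \<open>cmod a / 4\<close>; together they
    make the radius \<open>?\<delta>\<close> positive.\<close>
  define s0 where "s0 = min (1/2) (cmod a / (4 * (1 + cmod d)))"
  have "s0 \<le> 1/2" unfolding s0_def by (rule min.cobounded1)
  moreover have "0 < s0" using a by (auto simp: s0_def add_pos_nonneg)
  ultimately have s0: "0 < s0" "s0 \<le> 1/2" by auto
  have "s0 * cmod d \<le> cmod a / 4"
  proof -
    have "s0 * cmod d \<le> cmod a / (4 * (1 + cmod d)) * cmod d"
      by (intro mult_right_mono) (auto simp: s0_def)
    also have "\<dots> \<le> cmod a / 4"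
      using a by (simp add: divide_simps add_pos_nonneg)
    finally show ?thesis .
  qed
  moreover have "cmod a / 2 \<le> cmod a * sqrt (1 - s0\<^sup>2)"
  proof -
    have "s0\<^sup>2 \<le> (1/2)\<^sup>2" using s0 by (intro power_mono) auto
    then have "(1/2)\<^sup>2 \<le> 1 - s0\<^sup>2" by (simp add: power2_eq_square)
    then have "1/2 \<le> sqrt (1 - s0\<^sup>2)" by (rule real_le_rsqrt)
    then show ?thesis using a by (simp add: mult.commute)
  qed
  ultimately have "s0 * cmod d < cmod a * sqrt (1 - s0\<^sup>2)" using a by linarith
  then have \<delta>pos: "0 < s0 * (cmod a * sqrt (1 - s0\<^sup>2) - s0 * cmod d)" (is "0 < ?\<delta>")
    using s0 by simp
  have "ball l ?\<delta> \<subseteq> num_range T"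
  proof
    fix z assume "z \<in> ball l ?\<delta>"
    define w where "w = z - l"
    have w: "cmod w < ?\<delta>" using \<open>z \<in> ball l ?\<delta>\<close> by (simp add: w_def dist_norm norm_minus_commute)
    \<comment> \<open>The modulus of the off-diagonal term at \<open>s\<close>, minus the modulus it
      must have for the point to be \<open>z\<close>. It is at most 0 at 0, and nonnegative at
      \<open>s0\<close> because \<open>cmod w\<close> is below the radius.\<close>
    define g where "g = (\<lambda>s::real. cmod a * (sqrt (1 - s\<^sup>2) * s) - cmod (w - s\<^sup>2 * d))"
    have "cmod (w - s0\<^sup>2 * d) \<le> cmod w + s0\<^sup>2 * cmod d"
      by (rule order_trans [OF norm_triangle_ineq4]) (simp add: norm_mult norm_power)
    then have "0 \<le> g s0" using w by (simp add: g_def algebra_simps power2_eq_square)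
    moreover have "g 0 \<le> 0" by (simp add: g_def)
    moreover have "continuous_on {0..s0} g" unfolding g_def by (intro continuous_intros)
    ultimately obtain s where s: "0 \<le> s" "s \<le> s0" "g s = 0"
      using IVT' [of g 0 0 s0] s0 by auto
    define r where "r = sqrt (1 - s\<^sup>2)"
    have "s\<^sup>2 \<le> (1/2)\<^sup>2" using s s0 by (intro power_mono) auto
    then have s2: "s\<^sup>2 \<le> 1" by (simp add: power2_eq_square)
    then have rs: "r\<^sup>2 + s\<^sup>2 = 1" and r: "0 \<le> r" by (simp_all add: r_def)
    define q where "q = a * (complex_of_real r * s)"
    have pq: "cmod (w - s\<^sup>2 * d) = cmod q"
      using s r by (simp add: g_def q_def r_def norm_mult)
    \<comment> \<open>Numbers of equal modulus differ by a phase; if \<open>q = 0\<close>, both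
      vanish and any phase serves.\<close>
    obtain u where u: "cmod u = 1" "w - s\<^sup>2 * d = q * u"
    proof (cases "q = 0")
      case True
      then show ?thesis using that [of 1] pq by simp
    next
      case False
      then show ?thesis using that [of "(w - s\<^sup>2 * d) / q"] pq by (simp add: norm_divide)
    qed
    have "l + s\<^sup>2 * (T $$ (m,m) - l) + T $$ (j,m) * (r * s) * u \<in> num_range T"
      by (rule num_range_two_coords [OF T j m jm col rs u(1)])
    also have "l + s\<^sup>2 * (T $$ (m,m) - l) + T $$ (j,m) * (r * s) * u = l + (s\<^sup>2 * d + q * u)"
      by (simp add: d_def q_def a_def)
    also have "\<dots> = z" using u(2) by (simp add: w_def algebra_simps)
    finally show "z \<in> num_range T" .
  qed
  then have "l \<in> interior (num_range T)" using \<delta>pos by (meson centre_in_ball interiorI open_ball)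
  then show False using l by (simp add: frontier_def)
qed

text \<open>Strong induction on the row: the entry \<open>T $$ (m,i)\<close> vanishes for
  \<open>m < i\<close> because row \<open>m\<close> is already done, and for \<open>m > i\<close> by
  triangularity. This is the column hypothesis of \<open>boundary_eigenvalue_row\<close>, which then
  clears row \<open>i\<close>.\<close>

lemma boundary_eigenvalue_reduces:
  fixes T :: "complex mat"
  assumes T: "T \<in> carrier_mat n n" and ut: "upper_triangular T" and kn: "k \<le> n"
    and diag: "\<And>i. i < k \<Longrightarrow> T $$ (i,i) = l"
    and l: "l \<in> frontier (num_range T)"
    and "i < k" "m < n" "m \<noteq> i"
  shows "T $$ (i,m) = 0"
  using assms(6-)
proof (induction i arbitrary: m rule: less_induct)
  case (less i)
  have "T $$ (m,i) = 0"
  proof (cases "m < i")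
    case True
    then show ?thesis using less kn by auto
  next
    case False
    then show ?thesis using upper_triangularD [OF ut, of i m] T less by auto
  qed
  then show ?case
    using boundary_eigenvalue_row [OF T _ less.prems(2) _ diag _ l] less kn by auto
qed

subsection \<open>Diagonal blocks of triangular matrices\<close>

text \<open>Offsets 0 and 1, with \<open>m\<close> one less than the size of \<open>T\<close>, give
  the leading and the trailing block to which the constant for size \<open>N - 1\<close>
  applies.\<close>

definition diag_block :: "nat \<Rightarrow> nat \<Rightarrow> complex mat \<Rightarrow> complex mat" where
  "diag_block s m T = mat m m (\<lambda>(i,j). T $$ (i + s, j + s))"

lemma diag_block_carrier [simp]: "diag_block s m T \<in> carrier_mat m m"
  by (simp add: diag_block_def)

lemma diag_block_index [simp]:
  "i < m \<Longrightarrow> j < m \<Longrightarrow> diag_block s m T $$ (i,j) = T $$ (i + s, j + s)"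
  by (simp add: diag_block_def)

lemma sum_shift_block:
  fixes f :: "nat \<Rightarrow> 'a::comm_monoid_add"
  assumes "s + m \<le> n" and "\<And>l. l < n \<Longrightarrow> \<not> (s \<le> l \<and> l < s + m) \<Longrightarrow> f l = 0"
  shows "(\<Sum>l<n. f l) = (\<Sum>l<m. f (l + s))"
proof -
  have "(\<Sum>l<n. f l) = (\<Sum>l\<in>{s..<s + m}. f l)"
    using assms by (intro sum.mono_neutral_right) auto
  also have "\<dots> = (\<Sum>l<m. f (l + s))"
    using sum.shift_bounds_nat_ivl [of f 0 s m] by (simp add: lessThan_atLeast0 add.commute)
  finally show ?thesis .
qed

lemma upper_triangular_mult:
  fixes S T :: "complex mat"
  assumes S: "S \<in> carrier_mat n n" "upper_triangular S" and T: "T \<in> carrier_mat n n" "upper_triangular T"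
  shows "upper_triangular (S * T)"
proof (rule upper_triangularI)
  fix i j assume ij: "j < i" "i < dim_row (S * T)"
  then have i: "i < n" and j: "j < n" using S by auto
  show "(S * T) $$ (i,j) = 0"
    unfolding mult_mat_sum [OF S(1) T(1) i j]
  proof (intro sum.neutral ballI)
    fix k assume k: "k \<in> {..<n}"
    show "S $$ (i,k) * T $$ (k,j) = 0"
      using upper_triangularD [OF S(2), of k i] upper_triangularD [OF T(2), of j k] k ij i S T
      by (cases "k < i") auto
  qed
qed

text \<open>In the product sum, triangularity of \<open>S\<close> kills the indices before
  \<open>s\<close> and triangularity of \<open>T\<close> those from \<open>s + m\<close> on. Hence
  taking a diagonal block is multiplicative on triangular matrices, and so commutes with
  polynomials.\<close>

lemma diag_block_mult:
  fixes S T :: "complex mat"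
  assumes S: "S \<in> carrier_mat n n" "upper_triangular S" and T: "T \<in> carrier_mat n n" "upper_triangular T"
    and sm: "s + m \<le> n"
  shows "diag_block s m (S * T) = diag_block s m S * diag_block s m T"
proof -
  have e: "diag_block s m (S * T) $$ (i,j) = (diag_block s m S * diag_block s m T) $$ (i,j)"
    if i: "i < m" and j: "j < m" for i j
  proof -
    have ij: "i + s < n" "j + s < n" using i j sm by auto
    have "diag_block s m (S * T) $$ (i,j) = (\<Sum>l<n. S $$ (i + s, l) * T $$ (l, j + s))"
      unfolding diag_block_index [OF i j] by (rule mult_mat_sum [OF S(1) T(1) ij])
    also have "\<dots> = (\<Sum>l<m. S $$ (i + s, l + s) * T $$ (l + s, j + s))"
    proof (rule sum_shift_block [OF sm])
      fix l assume "l < n" "\<not> (s \<le> l \<and> l < s + m)"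
      then show "S $$ (i + s, l) * T $$ (l, j + s) = 0"
        using upper_triangularD [OF S(2), of l "i + s"] upper_triangularD [OF T(2), of "j + s" l] S T ij i j
        by (cases "s \<le> l") auto
    qed
    also have "\<dots> = (diag_block s m S * diag_block s m T) $$ (i,j)"
      unfolding mult_mat_sum [OF diag_block_carrier diag_block_carrier i j] using i j by simp
    finally show ?thesis .
  qed
  have "diag_block s m S * diag_block s m T \<in> carrier_mat m m"
    by (rule mult_carrier_mat [OF diag_block_carrier diag_block_carrier])
  then show ?thesis using e diag_block_carrier [of s m "S * T"]
    by (metis (no_types, lifting) carrier_matD eq_matI)
qed

lemma diag_block_one: "s + m \<le> n \<Longrightarrow> diag_block s m (1\<^sub>m n) = 1\<^sub>m m"
  by (auto simp: diag_block_def)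

section \<open>Powers, polynomials and numerical range of diagonal blocks\<close>

context
  fixes T :: "complex mat" and n :: nat
  assumes T: "T \<in> carrier_mat n n" and ut: "upper_triangular T"
begin

lemma upper_triangular_pow: "upper_triangular (T ^\<^sub>m k)"
  using T ut by (induction k) (auto intro!: upper_triangular_mult)

lemma diag_block_pow: "s + m \<le> n \<Longrightarrow> diag_block s m (T ^\<^sub>m k) = diag_block s m T ^\<^sub>m k"
proof (induction k)
  case 0
  then show ?case using T by (simp add: diag_block_one) (simp add: diag_block_def)
next
  case (Suc k)
  then show ?case
    using diag_block_mult [OF pow_carrier_mat [OF T] upper_triangular_pow T ut] by simp
qed

lemma upper_triangular_poly_mat: "upper_triangular (poly_mat p T)"
proof (rule upper_triangularI)
  fix i j assume ij: "j < i" "i < dim_row (poly_mat p T)"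
  then have i: "i < n" and j: "j < n" using T by (auto simp: poly_mat_def)
  have "(T ^\<^sub>m k) $$ (i,j) = 0" for k
    using upper_triangularD [OF upper_triangular_pow, of j i k] ij i T by auto
  then show "poly_mat p T $$ (i,j) = 0"
    by (simp add: poly_mat_index [OF T i j])
qed

lemma diag_block_poly_mat:
  assumes sm: "s + m \<le> n"
  shows "diag_block s m (poly_mat p T) = poly_mat p (diag_block s m T)"
proof -
  have "diag_block s m (poly_mat p T) $$ (i,j) = poly_mat p (diag_block s m T) $$ (i,j)"
    if "i < m" "j < m" for i j
    using that sm
    by (simp add: poly_mat_index [OF T] poly_mat_index [OF diag_block_carrier] flip: diag_block_pow)
  then show ?thesis using diag_block_carrier [of s m] poly_mat_carrier [OF diag_block_carrier]
    by (metis (no_types, lifting) carrier_matD eq_matI)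
qed

lemma num_range_diag_block:
  assumes sm: "s + m \<le> n"
  shows "num_range (diag_block s m T) \<subseteq> num_range T"
proof
  fix z assume "z \<in> num_range (diag_block s m T)"
  then obtain x where x: "x \<in> carrier_vec m" "vnorm x = 1" "z = cinner (diag_block s m T *\<^sub>v x) x"
    by (auto simp: num_range_def diag_block_def)
  \<comment> \<open>Padding \<open>x\<close> with zeros keeps its norm, and the quadratic form of
    \<open>T\<close> at the padded vector is that of the block at \<open>x\<close>.\<close>
  define y where "y = vec n (\<lambda>l. if s \<le> l \<and> l < s + m then x $ (l - s) else 0)"
  have y: "y \<in> carrier_vec n" by (simp add: y_def)
  have y0: "y $ l = 0" if "l < n" "\<not> (s \<le> l \<and> l < s + m)" for l using that by (auto simp: y_def)
  have ys: "y $ (l + s) = x $ l" if "l < m" for l using that sm by (simp add: y_def)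
  have dy: "dim_vec y = n" and dx: "dim_vec x = m" using y x by auto
  have "(vnorm y)\<^sup>2 = (vnorm x)\<^sup>2"
    unfolding vnorm_sq dy dx using sum_shift_block [OF sm, of "\<lambda>l. (cmod (y $ l))\<^sup>2"] y0 ys by simp
  then have "vnorm y = 1" using x vnorm_nonneg [of y] by (simp add: power2_eq_1_iff)
  have Ty: "(T *\<^sub>v y) $ (i + s) = (diag_block s m T *\<^sub>v x) $ i" if i: "i < m" for i
  proof -
    have i': "i + s < n" using i sm by simp
    show ?thesis
      unfolding mult_mat_vec_sum [OF T y i'] mult_mat_vec_sum [OF diag_block_carrier x(1) i]
      using sum_shift_block [OF sm, of "\<lambda>l. T $$ (i + s, l) * y $ l"] y0 ys i by simp
  qed
  have "cinner (T *\<^sub>v y) y = (\<Sum>l<m. (T *\<^sub>v y) $ (l + s) * cnj (y $ (l + s)))"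
    unfolding cinner_def dy using y0 by (intro sum_shift_block [OF sm]) simp
  also have "\<dots> = z"
    unfolding x(3) cinner_def dx using Ty ys by simp
  finally show "z \<in> num_range T"
    unfolding num_range_def using T y \<open>vnorm y = 1\<close> by force
qed

end

section \<open>Norm of a triangular matrix from two overlapping diagonal blocks\<close>

lemma sum_split_overlap:
  fixes a :: "nat \<Rightarrow> 'a::comm_monoid_add"
  assumes "1 \<le> k" "k \<le> m"
  shows "(\<Sum>j<Suc m. a j) = (\<Sum>j<m. if j < k then a j else 0) + (\<Sum>j<m. if k \<le> Suc j then a (Suc j) else 0)"
proof -
  have "(\<Sum>j<Suc m. a j) = (\<Sum>j<Suc m. if j < k then a j else 0) + (\<Sum>j<Suc m. if k \<le> j then a j else 0)"
    unfolding sum.distrib [symmetric] by (intro sum.cong) auto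
  \<comment> \<open>The indices below \<open>k\<close> stay in the leading range because
    \<open>k \<le> m\<close>; those from \<open>k\<close> on avoid 0 because
    \<open>1 \<le> k\<close>, and so lie in the shifted range.\<close>
  also have "(\<Sum>j<Suc m. if j < k then a j else 0) = (\<Sum>j<m. if j < k then a j else 0)"
    using assms by simp
  also have "(\<Sum>j<Suc m. if k \<le> j then a j else 0) = (\<Sum>j<m. if k \<le> Suc j then a (Suc j) else 0)"
    unfolding sum.lessThan_Suc_shift using assms by simp
  finally show ?thesis .
qed

lemma vnorm_sq_le_opnorm:
  assumes B: "B \<in> carrier_mat n m" and x: "x \<in> carrier_vec m" and "opnorm B \<le> C"
  shows "(\<Sum>i<n. (cmod ((B *\<^sub>v x) $ i))\<^sup>2) \<le> C\<^sup>2 * (\<Sum>j<m. (cmod (x $ j))\<^sup>2)"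
proof -
  have "vnorm (B *\<^sub>v x) \<le> C * vnorm x"
    using opnorm_upper [OF B x] mult_right_mono [OF assms(3) vnorm_nonneg] by (rule order_trans)
  then have "(vnorm (B *\<^sub>v x))\<^sup>2 \<le> (C * vnorm x)\<^sup>2" by (intro power_mono) auto
  then show ?thesis using B x unfolding power_mult_distrib vnorm_sq by simp
qed

text \<open>Cut \<open>P\<close> at \<open>k\<close> into a block diagonal part and an upper right
  corner. The block diagonal part acts before \<open>k\<close> as the leading block on a truncated
  vector, and from \<open>k\<close> on as the trailing block on the complementary truncation. The
  squared norms add up, so this part has norm at most \<open>C\<close>; the corner is bounded by its
  entries.\<close>

lemma opnorm_le_diag_blocks:
  fixes P :: "complex mat"
  assumes P: "P \<in> carrier_mat (Suc m) (Suc m)" and ut: "upper_triangular P"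
    and k: "1 \<le> k" "k \<le> m" and C: "0 \<le> C"
    and b0: "opnorm (diag_block 0 m P) \<le> C" and b1: "opnorm (diag_block 1 m P) \<le> C"
  shows "opnorm P \<le> C + (\<Sum>i<Suc m. \<Sum>j<Suc m. if i < k \<and> k \<le> j then cmod (P $$ (i,j)) else 0)"
proof (rule opnorm_least [OF P])
  fix x :: "complex vec" assume x: "x \<in> carrier_vec (Suc m)" and x1: "vnorm x = 1"
  define D where "D = mat (Suc m) (Suc m) (\<lambda>(i,j). if (i < k \<longleftrightarrow> j < k) then P $$ (i,j) else 0)"
  define R where "R = mat (Suc m) (Suc m) (\<lambda>(i,j). if i < k \<and> k \<le> j then P $$ (i,j) else 0)"
  have D: "D \<in> carrier_mat (Suc m) (Suc m)" and R: "R \<in> carrier_mat (Suc m) (Suc m)"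
    by (auto simp: D_def R_def)
  have "P = D + R"
    using P upper_triangularD [OF ut] by (intro eq_matI) (auto simp: D_def R_def)
  then have Px: "P *\<^sub>v x = D *\<^sub>v x + R *\<^sub>v x"
    using add_mult_distrib_mat_vec [OF D R x] by simp
  have Rx: "vnorm (R *\<^sub>v x) \<le> (\<Sum>i<Suc m. \<Sum>j<Suc m. if i < k \<and> k \<le> j then cmod (P $$ (i,j)) else 0)"
  proof -
    have "(\<Sum>i<Suc m. \<Sum>j<Suc m. cmod (R $$ (i,j))) =
        (\<Sum>i<Suc m. \<Sum>j<Suc m. if i < k \<and> k \<le> j then cmod (P $$ (i,j)) else 0)"
      by (intro sum.cong refl) (auto simp: R_def)
    then show ?thesis using vnorm_mult_mat_vec_le [OF R x] x1 by simp
  qed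
  define y where "y = vec m (\<lambda>j. if j < k then x $ j else 0)"
  \<comment> \<open>The index is shifted by one because the trailing block starts at index
    1.\<close>
  define z where "z = vec m (\<lambda>j. if k \<le> Suc j then x $ Suc j else 0)"
  have y: "y \<in> carrier_vec m" and z: "z \<in> carrier_vec m" by (auto simp: y_def z_def)
  have Dy: "(D *\<^sub>v x) $ i = (diag_block 0 m P *\<^sub>v y) $ i" if i: "i < k" for i
  proof -
    have i': "i < Suc m" "i < m" using i k by auto
    have "(\<Sum>j<m. if k \<le> Suc j then D $$ (i, Suc j) * x $ Suc j else 0) = 0"
      using i i' by (intro sum.neutral) (auto simp: D_def)
    then show ?thesis
      unfolding mult_mat_vec_sum [OF D x i'(1)] mult_mat_vec_sum [OF diag_block_carrier y i'(2)]
        sum_split_overlap [OF k]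
      using i i' by (auto simp: D_def y_def intro!: sum.cong)
  qed
  have Dz: "(D *\<^sub>v x) $ Suc i = (diag_block 1 m P *\<^sub>v z) $ i" if i: "k \<le> Suc i" "i < m" for i
  proof -
    have i': "Suc i < Suc m" using i by auto
    have "(\<Sum>j<m. if j < k then D $$ (Suc i, j) * x $ j else 0) = 0"
      using i by (intro sum.neutral) (auto simp: D_def)
    then show ?thesis
      unfolding mult_mat_vec_sum [OF D x i'] mult_mat_vec_sum [OF diag_block_carrier z i(2)]
        sum_split_overlap [OF k]
      using i by (auto simp: D_def z_def intro!: sum.cong)
  qed
  have dims: "dim_vec (D *\<^sub>v x) = Suc m" "dim_vec x = Suc m" using D x by auto
  have "(vnorm (D *\<^sub>v x))\<^sup>2 =
      (\<Sum>i<m. if i < k then (cmod ((D *\<^sub>v x) $ i))\<^sup>2 else 0) +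
      (\<Sum>i<m. if k \<le> Suc i then (cmod ((D *\<^sub>v x) $ Suc i))\<^sup>2 else 0)"
    unfolding vnorm_sq dims by (rule sum_split_overlap [OF k])
  \<comment> \<open>Extending each sum to all rows of its block only adds nonnegative terms.\<close>
  also have "\<dots> \<le> (\<Sum>i<m. (cmod ((diag_block 0 m P *\<^sub>v y) $ i))\<^sup>2) +
      (\<Sum>i<m. (cmod ((diag_block 1 m P *\<^sub>v z) $ i))\<^sup>2)"
    by (intro add_mono sum_mono) (auto simp: Dy Dz simp del: index_mult_mat_vec)
  also have "\<dots> \<le> C\<^sup>2 * (\<Sum>j<m. (cmod (y $ j))\<^sup>2) + C\<^sup>2 * (\<Sum>j<m. (cmod (z $ j))\<^sup>2)"
    by (intro add_mono vnorm_sq_le_opnorm [OF diag_block_carrier] y z b0 b1)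
  also have "\<dots> = C\<^sup>2 * ((\<Sum>j<m. if j < k then (cmod (x $ j))\<^sup>2 else 0) +
      (\<Sum>j<m. if k \<le> Suc j then (cmod (x $ Suc j))\<^sup>2 else 0))"
    unfolding distrib_left by (intro arg_cong2 [of _ _ _ _ "(+)"] arg_cong [of _ _ "\<lambda>t. C\<^sup>2 * t"] sum.cong)
      (auto simp: y_def z_def)
  also have "\<dots> = C\<^sup>2 * (vnorm x)\<^sup>2"
    unfolding vnorm_sq dims sum_split_overlap [OF k, of "\<lambda>j. (cmod (x $ j))\<^sup>2"] ..
  finally have "(vnorm (D *\<^sub>v x))\<^sup>2 \<le> C\<^sup>2" using x1 by simp
  then have "vnorm (D *\<^sub>v x) \<le> C" using C by (rule power2_le_imp_le)
  moreover have "vnorm (P *\<^sub>v x) \<le> vnorm (D *\<^sub>v x) + vnorm (R *\<^sub>v x)"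
    unfolding Px using D R x by (intro vnorm_add_le [of _ "Suc m"]) auto
  ultimately show "vnorm (P *\<^sub>v x) \<le> C + (\<Sum>i<Suc m. \<Sum>j<Suc m. if i < k \<and> k \<le> j then cmod (P $$ (i,j)) else 0)"
    using Rx by linarith
qed simp

text \<open>Entry \<open>(i,j)\<close> of the commutation relation expresses
  \<open>(Ts q $$ (i,i) - Ts q $$ (j,j)) * Ps q $$ (i,j)\<close> through the other terms. By
  induction on \<open>j - i\<close> these tend to 0, while the coefficient tends to
  \<open>l - T $$ (j,j)\<close>, which is nonzero.\<close>

lemma off_diagonal_tendsto_0:
  fixes Ts Ps :: "nat \<Rightarrow> complex mat"
  assumes Ts: "\<And>q. Ts q \<in> carrier_mat n n" "\<And>q. upper_triangular (Ts q)"
    and Ps: "\<And>q. Ps q \<in> carrier_mat n n" "\<And>q. upper_triangular (Ps q)"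
    and comm: "\<And>q. Ts q * Ps q = Ps q * Ts q"
    and lim: "\<And>i j. i < n \<Longrightarrow> j < n \<Longrightarrow> (\<lambda>q. Ts q $$ (i,j)) \<longlonglongrightarrow> T $$ (i,j)"
    and diag: "\<And>i. i < k \<Longrightarrow> T $$ (i,i) = l" "\<And>j. k \<le> j \<Longrightarrow> j < n \<Longrightarrow> T $$ (j,j) \<noteq> l"
    and row: "\<And>i m. i < k \<Longrightarrow> m < n \<Longrightarrow> m \<noteq> i \<Longrightarrow> T $$ (i,m) = 0"
    and bound: "\<And>q i j. i < n \<Longrightarrow> j < n \<Longrightarrow> i < k \<longleftrightarrow> j < k \<Longrightarrow> cmod (Ps q $$ (i,j)) \<le> C"
    and ij: "i < k" "k \<le> j" "j < n"
  shows "(\<lambda>q. Ps q $$ (i,j)) \<longlonglongrightarrow> 0"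
  using ij
proof (induction "j - i" arbitrary: i j rule: less_induct)
  case less
  then have i: "i < n" and ij: "i < j" by auto
  \<comment> \<open>For \<open>m < k\<close> the factor from \<open>Ts\<close> tends to 0 and the
    one from \<open>Ps\<close> is bounded; for \<open>k \<le> m < j\<close> the induction hypothesis
    applies, since \<open>(i,m)\<close> is closer to the diagonal; for \<open>m > j\<close>
    triangularity gives 0.\<close>
  have PT: "(\<lambda>q. Ps q $$ (i,m) * Ts q $$ (m,j)) \<longlonglongrightarrow> 0" if m: "m \<in> {..<n} - {j}" for m
  proof (cases "m < k")
    case True
    then have "(\<lambda>q. Ts q $$ (m,j)) \<longlonglongrightarrow> 0"
      using lim [of m j] row [of m j] m less by auto
    then show ?thesis
      using bound [of i m] m i less True by (intro lim_null_mult_left_bounded [where B = C]) auto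
  next
    case False
    show ?thesis
    proof (cases "m < j")
      case True
      then have "(\<lambda>q. Ps q $$ (i,m)) \<longlonglongrightarrow> 0"
        using less False by (intro less.hyps) auto
      from tendsto_mult [OF this lim [of m j]] show ?thesis using m less by simp
    next
      case False
      then have "Ts q $$ (m,j) = 0" for q
        using upper_triangularD [OF Ts(2), of j m] carrier_matD [OF Ts(1)] m False by auto
      then show ?thesis by simp
    qed
  qed
  \<comment> \<open>The mirror image: a null factor from \<open>Ts\<close> for
    \<open>k \<le> m\<close>, the induction hypothesis for \<open>i < m < k\<close>, triangularity
    for \<open>m < i\<close>.\<close>
  have TP: "(\<lambda>q. Ts q $$ (i,m) * Ps q $$ (m,j)) \<longlonglongrightarrow> 0" if m: "m \<in> {..<n} - {i}" for m
  proof (cases "m < k")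
    case False
    then have "(\<lambda>q. Ts q $$ (i,m)) \<longlonglongrightarrow> 0"
      using lim [of i m] row [of i m] m i less by auto
    then show ?thesis
      using bound [of m j] m i less False by (intro lim_null_mult_right_bounded [where B = C]) auto
  next
    case True
    show ?thesis
    proof (cases "i < m")
      case im: True
      then have "(\<lambda>q. Ps q $$ (m,j)) \<longlonglongrightarrow> 0"
        using less True by (intro less.hyps) auto
      from tendsto_mult [OF lim [of i m] this] show ?thesis using m i by simp
    next
      case False
      then have "Ts q $$ (i,m) = 0" for q
        using upper_triangularD [OF Ts(2), of m i] carrier_matD [OF Ts(1)] i m False by auto
      then show ?thesis by simp
    qed
  qed
  define S where "S = (\<lambda>q. (\<Sum>m\<in>{..<n} - {j}. Ps q $$ (i,m) * Ts q $$ (m,j)) -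
    (\<Sum>m\<in>{..<n} - {i}. Ts q $$ (i,m) * Ps q $$ (m,j)))"
  have "S \<longlonglongrightarrow> (\<Sum>m\<in>{..<n} - {j}. 0) - (\<Sum>m\<in>{..<n} - {i}. 0)"
    unfolding S_def using PT TP by (intro tendsto_diff tendsto_sum) auto
  then have S0: "S \<longlonglongrightarrow> 0" by simp
  define d where "d = (\<lambda>q. Ts q $$ (i,i) - Ts q $$ (j,j))"
  have SP: "S q = d q * Ps q $$ (i,j)" for q
  proof -
    have "(\<Sum>m<n. Ts q $$ (i,m) * Ps q $$ (m,j)) = (\<Sum>m<n. Ps q $$ (i,m) * Ts q $$ (m,j))"
      using mult_mat_sum [OF Ts(1) Ps(1) i less.prems(3)] mult_mat_sum [OF Ps(1) Ts(1) i less.prems(3)]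
        comm by metis
    moreover have "(\<Sum>m<n. Ts q $$ (i,m) * Ps q $$ (m,j)) = Ts q $$ (i,i) * Ps q $$ (i,j) +
        (\<Sum>m\<in>{..<n} - {i}. Ts q $$ (i,m) * Ps q $$ (m,j))"
      using i by (intro sum.remove) auto
    moreover have "(\<Sum>m<n. Ps q $$ (i,m) * Ts q $$ (m,j)) = Ps q $$ (i,j) * Ts q $$ (j,j) +
        (\<Sum>m\<in>{..<n} - {j}. Ps q $$ (i,m) * Ts q $$ (m,j))"
      using less by (intro sum.remove) auto
    ultimately show ?thesis by (simp add: S_def d_def algebra_simps)
  qed
  have dlim: "d \<longlonglongrightarrow> T $$ (i,i) - T $$ (j,j)"
    unfolding d_def using i less by (intro tendsto_diff lim) auto
  have dnz: "T $$ (i,i) - T $$ (j,j) \<noteq> 0" using diag less by fastforce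
  \<comment> \<open>The coefficient \<open>d q\<close> may vanish for finitely many
    \<open>q\<close>, so the division is carried out only eventually.\<close>
  from tendsto_imp_eventually_ne [OF dlim dnz]
  have ev: "\<forall>\<^sub>F q in sequentially. S q / d q = Ps q $$ (i,j)"
    by eventually_elim (simp add: SP)
  have "(\<lambda>q. S q / d q) \<longlonglongrightarrow> 0"
    using tendsto_divide [OF S0 dlim dnz] by simp
  then show ?case using ev by (rule Lim_transform_eventually)
qed

section \<open>Simultaneous subsequences, entry bounds and eigenvalues on the diagonal\<close>

lemma finite_family_convergent_subseq:
  fixes f :: "nat \<Rightarrow> 'i \<Rightarrow> 'a::heine_borel"
  assumes "finite I" and "\<And>i. i \<in> I \<Longrightarrow> bounded (range (\<lambda>q. f q i))"
  shows "\<exists>r::nat \<Rightarrow> nat. strict_mono r \<and> (\<forall>i\<in>I. convergent (\<lambda>q. f (r q) i))"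
  using assms
proof (induction I rule: finite_induct)
  case empty
  then show ?case using strict_mono_id by auto
next
  case (insert a I)
  then obtain r where r: "strict_mono r" "\<forall>i\<in>I. convergent (\<lambda>q. f (r q) i)" by auto
  have "bounded (range (\<lambda>q. f (r q) a))"
    using insert.prems [of a] by (rule bounded_subset [of "range (\<lambda>q. f q a)"]) auto
  \<comment> \<open>A further subsequence handles the new index and preserves the convergence
    already obtained at the others.\<close>
  then obtain l s where s: "strict_mono s" "((\<lambda>q. f (r q) a) \<circ> s) \<longlonglongrightarrow> l"
    using bounded_imp_convergent_subsequence by blast
  have "convergent (\<lambda>q. f ((r \<circ> s) q) i)" if "i \<in> insert a I" for i
  proof (cases "i = a")
    case True
    then show ?thesis using s(2) by (auto simp: convergent_def o_def)
  next
    case False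
    then show ?thesis
      using that r(2) convergent_subseq_convergent [OF _ s(1), of "\<lambda>q. f (r q) i"] by (auto simp: o_def)
  qed
  then show ?case using strict_mono_o [OF r(1) s(1)] by blast
qed

lemma conjugated_entry:
  fixes A U :: "complex mat"
  assumes A: "A \<in> carrier_mat n n" and U: "U \<in> carrier_mat n n" and ij: "i < n" "j < n"
  shows "(mat_adjoint U * A * U) $$ (i,j) = (\<Sum>a<n. (\<Sum>b<n. cnj (U $$ (b,i)) * A $$ (b,a)) * U $$ (a,j))"
proof -
  note U' = mat_adjoint_carrier [OF U]
  show ?thesis
    unfolding mult_mat_sum [OF mult_carrier_mat [OF U' A] U ij]
    using ij by (intro sum.cong refl) (simp add: mult_mat_sum [OF U' A] mat_adjoint_index [OF U] del: index_mult_mat)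
qed

text \<open>A unitary matrix preserves norms, so its operator norm bounds every entry by 1; this is
  the boundedness behind the compactness argument.\<close>

lemma unitary_entry_le_1:
  assumes U: "unitary_mat n U" and ij: "i < n" "j < n"
  shows "cmod (U $$ (i,j)) \<le> 1"
proof -
  have Uc: "U \<in> carrier_mat n n" using U by (rule unitary_mat_carrier)
  have "opnorm U \<le> 1"
    using ij vnorm_unitary [OF U] by (intro opnorm_least [OF Uc]) auto
  with cmod_entry_le_opnorm [OF Uc ij] show ?thesis by simp
qed

lemma eigenvalue_upper_triangular:
  fixes T :: "'a::field mat"
  assumes T: "T \<in> carrier_mat n n" "upper_triangular T" and "eigenvalue T l"
  obtains i where "i < n" "T $$ (i,i) = l"
proof -
  have "poly (char_poly T) l = 0" using assms eigenvalue_root_char_poly by blast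
  then have "\<exists>a\<in>set (diag_mat T). a = l"
    unfolding char_poly_upper_triangular [OF T] by (auto simp: poly_prod_list_zero_iff)
  then show ?thesis using that T by (auto simp: diag_mat_def)
qed

subsection \<open>Convergence of triangular forms\<close>

text \<open>Compactness of the unitary group: a subsequence of the triangularizing matrices
  converges entrywise. The orthonormality relations and the entries of the conjugated matrices are
  polynomial in the entries and their conjugates, so both pass to the limit.\<close>

lemma unitary_schur_convergent_subseq:
  fixes As :: "nat \<Rightarrow> complex mat" and f :: "complex \<Rightarrow> real"
  assumes As: "\<And>q. As q \<in> carrier_mat n n" and A: "A \<in> carrier_mat n n"
    and lim: "\<And>i j. i < n \<Longrightarrow> j < n \<Longrightarrow> (\<lambda>q. As q $$ (i,j)) \<longlonglongrightarrow> A $$ (i,j)"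
  obtains r :: "nat \<Rightarrow> nat" and Us U where "strict_mono r"
    "\<And>q. unitary_mat n (Us q)" "unitary_mat n U"
    "\<And>q. upper_triangular (mat_adjoint (Us q) * As (r q) * Us q)"
    "\<And>q i j. i \<le> j \<Longrightarrow> j < n \<Longrightarrow>
      f ((mat_adjoint (Us q) * As (r q) * Us q) $$ (i,i)) \<le> f ((mat_adjoint (Us q) * As (r q) * Us q) $$ (j,j))"
    "\<And>i j. i < n \<Longrightarrow> j < n \<Longrightarrow>
      (\<lambda>q. (mat_adjoint (Us q) * As (r q) * Us q) $$ (i,j)) \<longlonglongrightarrow> (mat_adjoint U * A * U) $$ (i,j)"
proof -
  have "\<exists>V. unitary_mat n V \<and> upper_triangular (mat_adjoint V * As q * V) \<and>
      (\<forall>i j. i \<le> j \<longrightarrow> j < n \<longrightarrow>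
        f ((mat_adjoint V * As q * V) $$ (i,i)) \<le> f ((mat_adjoint V * As q * V) $$ (j,j)))" for q
    using unitary_schur_sorted [OF As [of q], of f] by metis
  then obtain V where V: "\<And>q. unitary_mat n (V q)"
    "\<And>q. upper_triangular (mat_adjoint (V q) * As q * V q)"
    "\<And>q i j. i \<le> j \<Longrightarrow> j < n \<Longrightarrow>
        f ((mat_adjoint (V q) * As q * V q) $$ (i,i)) \<le> f ((mat_adjoint (V q) * As q * V q) $$ (j,j))"
    by metis
  have "bounded (range (\<lambda>q. V q $$ ij))" if ij: "ij \<in> {..<n} \<times> {..<n}" for ij
    using unitary_entry_le_1 [OF V(1)] ij by (intro boundedI [of _ 1]) auto
  then obtain r :: "nat \<Rightarrow> nat" where r: "strict_mono r"
    and conv: "\<And>ij. ij \<in> {..<n} \<times> {..<n} \<Longrightarrow> convergent (\<lambda>q. V (r q) $$ ij)"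
    using finite_family_convergent_subseq [of "{..<n} \<times> {..<n}" "\<lambda>q ij. V q $$ ij"] by auto
  define U where "U = mat n n (\<lambda>ij. lim (\<lambda>q. V (r q) $$ ij))"
  have Uc: "U \<in> carrier_mat n n" by (simp add: U_def)
  have Vc: "V q \<in> carrier_mat n n" for q using V(1) by (rule unitary_mat_carrier)
  have Ulim: "(\<lambda>q. V (r q) $$ (i,j)) \<longlonglongrightarrow> U $$ (i,j)" if "i < n" "j < n" for i j
    using conv [of "(i,j)"] that by (simp add: U_def convergent_LIMSEQ_iff)
  have "(\<Sum>k<n. cnj (U $$ (k,i)) * U $$ (k,j)) = (if i = j then 1 else 0)" if ij: "i < n" "j < n" for i j
  proof (rule LIMSEQ_unique)
    show "(\<lambda>q. \<Sum>k<n. cnj (V (r q) $$ (k,i)) * V (r q) $$ (k,j)) \<longlonglongrightarrow> (\<Sum>k<n. cnj (U $$ (k,i)) * U $$ (k,j))"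
      using ij by (intro tendsto_sum tendsto_mult tendsto_cnj Ulim) auto
    show "(\<lambda>q. \<Sum>k<n. cnj (V (r q) $$ (k,i)) * V (r q) $$ (k,j)) \<longlonglongrightarrow> (if i = j then 1 else 0)"
      using V(1) ij unfolding unitary_mat_iff [OF Vc] by simp
  qed
  then have U: "unitary_mat n U" unfolding unitary_mat_iff [OF Uc] by blast
  have lim': "(\<lambda>q. As (r q) $$ (i,j)) \<longlonglongrightarrow> A $$ (i,j)" if "i < n" "j < n" for i j
    using LIMSEQ_subseq_LIMSEQ [OF lim [OF that] r] by (simp add: o_def)
  have "(\<lambda>q. (mat_adjoint (V (r q)) * As (r q) * V (r q)) $$ (i,j)) \<longlonglongrightarrow> (mat_adjoint U * A * U) $$ (i,j)"
    if ij: "i < n" "j < n" for i j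
    unfolding conjugated_entry [OF As Vc ij] conjugated_entry [OF A Uc ij]
    using ij by (intro tendsto_sum tendsto_mult tendsto_cnj Ulim lim') auto
  then show ?thesis using that [of r "\<lambda>q. V (r q)" U] r U V by blast
qed

text \<open>Sorting by distance to \<open>l\<close> puts all copies of \<open>l\<close> first on the
  diagonal; \<open>k\<close> counts them, and their rows are cleared because \<open>l\<close> is a
  boundary point.\<close>

lemma limit_schur_form:
  fixes T :: "complex mat"
  assumes n: "n > 0" and T: "T \<in> carrier_mat n n" "upper_triangular T"
    and sorted: "\<And>i j. i \<le> j \<Longrightarrow> j < n \<Longrightarrow> cmod (T $$ (i,i) - l) \<le> cmod (T $$ (j,j) - l)"
    and l: "eigenvalue T l" "l \<in> frontier (num_range T)"
    and nonscalar: "T \<noteq> l \<cdot>\<^sub>m 1\<^sub>m n"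
  obtains k where "1 \<le> k" "k < n" "\<And>i. i < k \<Longrightarrow> T $$ (i,i) = l"
    "\<And>j. k \<le> j \<Longrightarrow> j < n \<Longrightarrow> T $$ (j,j) \<noteq> l"
    "\<And>i m. i < k \<Longrightarrow> m < n \<Longrightarrow> m \<noteq> i \<Longrightarrow> T $$ (i,m) = 0"
proof -
  \<comment> \<open>If the whole diagonal were \<open>l\<close>, every row would be cleared and
    \<open>T\<close> would be scalar.\<close>
  have "\<exists>j<n. T $$ (j,j) \<noteq> l"
  proof (rule ccontr)
    assume "\<not> (\<exists>j<n. T $$ (j,j) \<noteq> l)"
    then have d: "\<And>j. j < n \<Longrightarrow> T $$ (j,j) = l" by blast
    have "T = l \<cdot>\<^sub>m 1\<^sub>m n"
      using T d boundary_eigenvalue_reduces [OF T order_refl d l(2)] by (intro eq_matI) auto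
    then show False using nonscalar by simp
  qed
  define k where "k = (LEAST j. j < n \<and> T $$ (j,j) \<noteq> l)"
  have k: "k < n" "T $$ (k,k) \<noteq> l"
    using LeastI_ex [OF \<open>\<exists>j<n. T $$ (j,j) \<noteq> l\<close>] by (auto simp: k_def)
  have below: "T $$ (i,i) = l" if "i < k" for i
    using not_less_Least [of i "\<lambda>j. j < n \<and> T $$ (j,j) \<noteq> l"] that k by (auto simp: k_def)
  \<comment> \<open>By sorting, these entries are at least as far from \<open>l\<close> as the entry
    at \<open>k\<close>, which differs from \<open>l\<close>.\<close>
  have above: "T $$ (j,j) \<noteq> l" if "k \<le> j" "j < n" for j
    using sorted [OF that] k by auto
  obtain i where "i < n" "T $$ (i,i) = l" using eigenvalue_upper_triangular [OF T l(1)] .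
  \<comment> \<open>The eigenvalue \<open>l\<close> occurs on the diagonal, and by
    \<open>above\<close> only before \<open>k\<close>.\<close>
  then have "1 \<le> k" using above [of i] by (cases k) auto
  then show ?thesis
    using that [of k] k below above boundary_eigenvalue_reduces [OF T less_imp_le [OF k(1)] below l(2)]
    by blast
qed

text \<open>Taking the block commutes with \<open>poly_mat p\<close>, and the numerical range of the
  block lies in that of \<open>T\<close>; thus \<open>p\<close> competes in the supremum defining
  the Crouzeix ratio of the block.\<close>

lemma opnorm_poly_diag_block_le:
  assumes T: "T \<in> carrier_mat n n" "upper_triangular T" and sm: "s + m \<le> n"
    and p: "\<forall>z\<in>num_range T. cmod (poly p z) \<le> 1" and C: "crouzeix_const m \<le> ereal C"
  shows "opnorm (diag_block s m (poly_mat p T)) \<le> C"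
proof -
  let ?B = "diag_block s m T"
  have "ereal (opnorm (poly_mat p ?B)) \<le> crouzeix_ratio ?B"
    unfolding crouzeix_ratio_def
    using p num_range_diag_block [OF T sm] by (intro SUP_upper) auto
  also have "\<dots> \<le> crouzeix_const m"
    unfolding crouzeix_const_def by (intro SUP_upper) auto
  also note C
  finally show ?thesis by (simp add: diag_block_poly_mat [OF T sm])
qed

section \<open>Bounding the limit superior of the Crouzeix ratios\<close>

theorem theorem3p1:
  fixes N :: nat and A :: "complex mat" and As :: "nat \<Rightarrow> complex mat"
  assumes "N \<ge> 2"
    and "A \<in> carrier_mat N N"
    and "\<not> (\<exists>c. A = c \<cdot>\<^sub>m 1\<^sub>m N)"
    and "spectrum A \<inter> frontier (num_range A) \<noteq> {}"
    and "\<And>n. As n \<in> carrier_mat N N"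
    and "(\<lambda>n. opnorm (As n - A)) \<longlonglongrightarrow> 0"
  shows "limsup (\<lambda>n. crouzeix_ratio (As n)) \<le> crouzeix_const (N - 1)"
proof (rule ccontr)
  note A = assms(2) and As = assms(5)
  assume "\<not> ?thesis"
  then have "crouzeix_const (N - 1) < limsup (\<lambda>n. crouzeix_ratio (As n))" by simp
  \<comment> \<open>Two real thresholds are placed in the gap: \<open>b\<close> is exceeded by
    ratios arbitrarily far out, \<open>C\<close> will bound the blocks, and \<open>C < b\<close> is
    what the limit contradicts.\<close>
  then obtain b where b: "crouzeix_const (N - 1) < ereal b" "ereal b < limsup (\<lambda>n. crouzeix_ratio (As n))"
    using ereal_dense2 by blast
  obtain C where C: "crouzeix_const (N - 1) < ereal C" "C < b"
    using ereal_dense2 [OF b(1)] by auto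
  have "\<exists>q\<ge>K. ereal b < crouzeix_ratio (As q)" for K
  proof (rule ccontr)
    assume "\<not> ?thesis"
    then have "\<forall>\<^sub>F q in sequentially. crouzeix_ratio (As q) \<le> ereal b"
      by (auto simp: eventually_sequentially not_less intro!: exI [of _ K])
    then show False using Limsup_bounded b(2) by (metis not_less)
  qed
  \<comment> \<open>The bound \<open>K \<le> s K\<close> makes \<open>s\<close> tend to infinity, so
    \<open>As (s K)\<close> still converges to \<open>A\<close>.\<close>
  then obtain s where s: "\<And>K. K \<le> s K" "\<And>K. ereal b < crouzeix_ratio (As (s K))" by metis
  have "\<exists>p. (\<forall>z\<in>num_range (As (s K)). cmod (poly p z) \<le> 1) \<and> b < opnorm (poly_mat p (As (s K)))" for K
    using s(2) [of K] unfolding crouzeix_ratio_def less_SUP_iff by auto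
  then obtain p where p: "\<And>K z. z \<in> num_range (As (s K)) \<Longrightarrow> cmod (poly (p K) z) \<le> 1"
    "\<And>K. b < opnorm (poly_mat (p K) (As (s K)))" by metis
  have "filterlim s at_top sequentially"
    by (rule filterlim_at_top_mono [OF filterlim_ident]) (use s(1) in auto)
  then have normlim: "(\<lambda>K. opnorm (As (s K) - A)) \<longlonglongrightarrow> 0"
    by (rule filterlim_compose [OF assms(6)])
  have entry: "(\<lambda>K. As (s K) $$ (i,j)) \<longlonglongrightarrow> A $$ (i,j)" if ij: "i < N" "j < N" for i j
  proof -
    have "cmod (As (s K) $$ (i,j) - A $$ (i,j)) \<le> opnorm (As (s K) - A)" for K
      using cmod_entry_le_opnorm [OF minus_carrier_mat [OF A, of "As (s K)"] ij] A ij by auto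
    then have "(\<lambda>K. As (s K) $$ (i,j) - A $$ (i,j)) \<longlonglongrightarrow> 0"
      by (intro Lim_null_comparison [OF _ normlim]) auto
    then show ?thesis by (simp add: LIM_zero_iff)
  qed
  obtain l where l: "eigenvalue A l" "l \<in> frontier (num_range A)"
    using assms(4) by (auto simp: spectrum_def)
  obtain r :: "nat \<Rightarrow> nat" and Us U where r: "strict_mono r"
    and Us: "\<And>q. unitary_mat N (Us q)" and U: "unitary_mat N U"
    and ut: "\<And>q. upper_triangular (mat_adjoint (Us q) * As (s (r q)) * Us q)"
    and sorted: "\<And>q i j. i \<le> j \<Longrightarrow> j < N \<Longrightarrow>
      cmod ((mat_adjoint (Us q) * As (s (r q)) * Us q) $$ (i,i) - l) \<le>
      cmod ((mat_adjoint (Us q) * As (s (r q)) * Us q) $$ (j,j) - l)"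
    and lim: "\<And>i j. i < N \<Longrightarrow> j < N \<Longrightarrow>
      (\<lambda>q. (mat_adjoint (Us q) * As (s (r q)) * Us q) $$ (i,j)) \<longlonglongrightarrow> (mat_adjoint U * A * U) $$ (i,j)"
    using unitary_schur_convergent_subseq [where As = "\<lambda>K. As (s K)" and f = "\<lambda>z. cmod (z - l)", OF As A entry]
    by blast
  define T where "T = mat_adjoint U * A * U"
  define Ts where "Ts = (\<lambda>q. mat_adjoint (Us q) * As (s (r q)) * Us q)"
  define Ps where "Ps = (\<lambda>q. poly_mat (p (r q)) (Ts q))"
  note Uc = unitary_mat_carrier [OF U] and Usc = unitary_mat_carrier [OF Us]
  have Tc: "T \<in> carrier_mat N N"
    unfolding T_def by (rule mult_carrier_mat [OF mult_carrier_mat [OF mat_adjoint_carrier [OF Uc] A] Uc])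
  have Tsc: "Ts q \<in> carrier_mat N N" for q
    unfolding Ts_def
    by (rule mult_carrier_mat [OF mult_carrier_mat [OF mat_adjoint_carrier [OF Usc] As] Usc])
  have Tsut: "upper_triangular (Ts q)" for q using ut by (simp add: Ts_def)
  have Tlim: "(\<lambda>q. Ts q $$ (i,j)) \<longlonglongrightarrow> T $$ (i,j)" if "i < N" "j < N" for i j
    unfolding Ts_def T_def by (rule lim [OF that])
  have AT: "A = U * T * mat_adjoint U"
    unfolding T_def by (rule unitary_similar_sym [OF U A])
  have AsTs: "As (s (r q)) = Us q * Ts q * mat_adjoint (Us q)" for q
    unfolding Ts_def by (rule unitary_similar_sym [OF Us As])
  have Tut: "upper_triangular T"
  proof (rule upper_triangularI)
    fix i j assume "j < i" "i < dim_row T"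
    then have ij: "i < N" "j < N" "j < i" using Tc by auto
    then have "Ts q $$ (i,j) = 0" for q
      using upper_triangularD [OF Tsut, of j i] carrier_matD [OF Tsc] by auto
    then show "T $$ (i,j) = 0" using Tlim [OF ij(1,2)] by (simp add: LIMSEQ_const_iff)
  qed
  have Tsorted: "cmod (T $$ (i,i) - l) \<le> cmod (T $$ (j,j) - l)" if "i \<le> j" "j < N" for i j
  proof (rule LIMSEQ_le)
    show "(\<lambda>q. cmod (Ts q $$ (i,i) - l)) \<longlonglongrightarrow> cmod (T $$ (i,i) - l)"
      "(\<lambda>q. cmod (Ts q $$ (j,j) - l)) \<longlonglongrightarrow> cmod (T $$ (j,j) - l)"
      using that by (intro tendsto_norm tendsto_diff Tlim tendsto_const; simp)+
  qed (use sorted that in \<open>auto simp: Ts_def\<close>)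
  have "similar_mat A T"
    unfolding similar_mat_def
  proof (intro exI)
    show "similar_mat_wit A T U (mat_adjoint U)"
      using U unitary_mat_right [OF U] AT unfolding unitary_mat_def
      by (intro similar_mat_witI [OF _ _ _ A Tc Uc mat_adjoint_carrier [OF Uc]]) blast+
  qed
  then have "char_poly A = char_poly T" by (rule char_poly_similar)
  then have evT: "eigenvalue T l"
    using l(1) by (simp add: eigenvalue_root_char_poly [OF A] eigenvalue_root_char_poly [OF Tc])
  have frT: "l \<in> frontier (num_range T)"
    using l(2) num_range_unitary [OF U Tc] AT by simp
  \<comment> \<open>Unitary conjugation fixes scalar matrices, so a scalar \<open>T\<close> would
    make \<open>A\<close> scalar.\<close>
  have "T \<noteq> l \<cdot>\<^sub>m 1\<^sub>m N"
  proof
    assume "T = l \<cdot>\<^sub>m 1\<^sub>m N"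
    then have "A = l \<cdot>\<^sub>m (U * mat_adjoint U)"
      unfolding AT using Uc mat_adjoint_carrier [OF Uc]
      by (metis mult_smult_assoc_mat mult_smult_distrib one_carrier_mat right_mult_one_mat)
    then show False using unitary_mat_right [OF U] assms(3) by metis
  qed
  then obtain k where k: "1 \<le> k" "k < N" and diag: "\<And>i. i < k \<Longrightarrow> T $$ (i,i) = l"
    "\<And>j. k \<le> j \<Longrightarrow> j < N \<Longrightarrow> T $$ (j,j) \<noteq> l"
    and row: "\<And>i m. i < k \<Longrightarrow> m < N \<Longrightarrow> m \<noteq> i \<Longrightarrow> T $$ (i,m) = 0"
    using limit_schur_form [OF _ Tc Tut Tsorted evT frT] assms(1) by auto
  obtain m where m: "N = Suc m" "k \<le> m" using k by (cases N) auto
  have Psc: "Ps q \<in> carrier_mat N N" for q unfolding Ps_def by (rule poly_mat_carrier [OF Tsc])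
  have Psut: "upper_triangular (Ps q)" for q
    unfolding Ps_def by (rule upper_triangular_poly_mat [OF Tsc Tsut])
  \<comment> \<open>Unitarily similar matrices have the same numerical range, so the polynomials
    chosen for \<open>As (s (r q))\<close> remain admissible for \<open>Ts q\<close>.\<close>
  have admissible: "\<forall>z\<in>num_range (Ts q). cmod (poly (p (r q)) z) \<le> 1" for q
    using p(1) [of _ "r q"] num_range_unitary [OF Us Tsc] AsTs by simp
  have block: "opnorm (diag_block t m (Ps q)) \<le> C" if "t + m \<le> N" for t q
    unfolding Ps_def using C(1) m
    by (intro opnorm_poly_diag_block_le [OF Tsc Tsut that admissible]) simp
  \<comment> \<open>Two indices on the same side of the cut share a block: below
    \<open>k \<le> m\<close> the leading one, and from \<open>k \<ge> 1\<close> on the trailing one,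
    where both are shifted by one.\<close>
  have bound: "cmod (Ps q $$ (i,j)) \<le> C" if ij: "i < N" "j < N" "i < k \<longleftrightarrow> j < k" for q i j
  proof (cases "i < k")
    case True
    then show ?thesis
      using cmod_entry_le_opnorm [OF diag_block_carrier, of i m j 0 "Ps q"] block [of 0 q] ij m by simp
  next
    case False
    then obtain i' j' where "i = Suc i'" "j = Suc j'" using ij k by (cases i; cases j) auto
    then show ?thesis
      using cmod_entry_le_opnorm [OF diag_block_carrier, of i' m j' 1 "Ps q"] block [of 1 q] ij m by simp
  qed
  \<comment> \<open>\<open>C\<close> bounds the modulus of the entry \<open>(0,0)\<close>, which
    lies in the first block.\<close>
  have "0 \<le> C" using bound [of 0 0 0] k by (meson dual_order.trans norm_ge_zero not_less0 not_le)
  have comm: "Ts q * Ps q = Ps q * Ts q" for q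
    unfolding Ps_def by (rule poly_mat_intertwine [OF Tsc Tsc Tsc refl, symmetric])
  have offdiag: "(\<lambda>q. Ps q $$ (i,j)) \<longlonglongrightarrow> 0" if "i < k" "k \<le> j" "j < N" for i j
    by (rule off_diagonal_tendsto_0 [OF Tsc Tsut Psc Psut comm Tlim diag row bound that])
  have "(\<lambda>q. if i < k \<and> k \<le> j then cmod (Ps q $$ (i,j)) else 0) \<longlonglongrightarrow> 0" if "j < N" for i j
    using offdiag that by (cases "i < k \<and> k \<le> j") (auto intro: tendsto_norm_zero)
  then have "(\<lambda>q. C + (\<Sum>i<Suc m. \<Sum>j<Suc m. if i < k \<and> k \<le> j then cmod (Ps q $$ (i,j)) else 0)) \<longlonglongrightarrow>
      C + (\<Sum>i<Suc m. \<Sum>j<Suc m. 0)"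
    using m by (intro tendsto_add tendsto_const tendsto_sum) auto
  then have "(\<lambda>q. C + (\<Sum>i<Suc m. \<Sum>j<Suc m. if i < k \<and> k \<le> j then cmod (Ps q $$ (i,j)) else 0)) \<longlonglongrightarrow> C"
    by simp
  moreover have "b \<le> C + (\<Sum>i<Suc m. \<Sum>j<Suc m. if i < k \<and> k \<le> j then cmod (Ps q $$ (i,j)) else 0)" for q
  proof -
    have "poly_mat (p (r q)) (As (s (r q))) = Us q * Ps q * mat_adjoint (Us q)"
      unfolding AsTs Ps_def by (rule poly_mat_unitary [OF Us Tsc])
    then have "opnorm (poly_mat (p (r q)) (As (s (r q)))) = opnorm (Ps q)"
      using opnorm_unitary [OF Us Psc] by simp
    moreover have "opnorm (Ps q) \<le>
        C + (\<Sum>i<Suc m. \<Sum>j<Suc m. if i < k \<and> k \<le> j then cmod (Ps q $$ (i,j)) else 0)"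
      using m by (intro opnorm_le_diag_blocks Psut k(1) block \<open>0 \<le> C\<close>)
        (use Psc m in auto)
    ultimately show ?thesis using p(2) [of "r q"] by simp
  qed
  ultimately have "b \<le> C" by (intro LIMSEQ_le_const) auto
  then show False using C(2) by simp
qed

end
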